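(* Under Assumptions A, B, C1, C2, C3 (stated in the context), as $c\to\infty$, $$\mathrm{argmin}_h\,\Lambda_c(h)\ \rightarrow_d\ \tilde L\equiv\mathrm{argmin}_h\,\tilde\Lambda(h).$$
   Context: Setting. Fix $\theta^0\in(0,1)$ and a smooth bounded monotone (increasing) function $f:\mathbb{R}\to\mathbb{R}$; write $\beta_l^0=f(-\infty)$ and $\beta_u^0=f(\infty)$ for its limits. Let $\alpha_n>0$, $\alpha_n\to\infty$, and $f_n(x)=f(\alpha_n(x-\theta^0))$. At stage $n$, $Y=f_n(X)+\epsilon$, where $X$ takes values in $[0,1]$ with density $p_X$, and $\epsilon$ is a continuous random variable independent of $X$ with $E\epsilon=0$ and finite variance $\sigma^2$. It is assumed that $(\theta,\beta_l,\beta_u)\mapsto E\{Y-\beta_l1(X\le\theta)-\beta_u1(X>\theta)\}^2$ (expectation at stage $n$) has a unique minimizer $(\theta^n,\beta_l^n,\beta_u^n)$, with $\beta_l^n\ne\beta_u^n$. Put $\xi^n=\alpha_n(\theta^n-\theta^0)$ and $\xi^0=f^{-1}((\beta_l^0+\beta_u^0)/2)$. Assumptions. A. $f$ is continuously differentiable in an open neighborhood of $\xi^0$ with $f'(\xi^0)>0$. B. $p_X$ does not vanish and is continuously differentiable in a neighborhood of $\theta^0$. C1. $\inf_n\liminf_{|h_1|\to\infty}\frac1{|h_1|}\int_0^{h_1}[f(t+\xi^n)-f(\xi^n)]\,dt>0$. C2. For every constant $K>0$, $\inf_n\inf_{u\in[-K+\xi^n,K+\xi^n]}f'(u)>0$.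 C3. The integrals $\xi^l=\int_{-\infty}^{\xi^0}(f(t)-\beta_l^0)\,dt$ and $\xi^u=\int_{\xi^0}^{\infty}(f(t)-\beta_u^0)\,dt$ exist. Processes. Let $\nu^+$ be a homogeneous Poisson process on $[0,\infty)$ with rate $p_X(\theta^0)$ and right-continuous sample paths with left limits, with arrival times $S_1<S_2<\cdots$; $\nu^-$ a homogeneous Poisson process on $[0,\infty)$ with rate $p_X(\theta^0)$ and left-continuous sample paths with right limits, with arrival times $\tilde S_1<\tilde S_2<\cdots$; $\{\epsilon_j\}_{j\ge1}$ and $\{\tilde\epsilon_j\}_{j\ge1}$ i.i.d. copies of $\epsilon$; all four are independent. For $c>0$ (empty sums are zero), $$\Lambda_c(h)=\left\{\sum_{j=1}^{\nu^+(h)}\left(\epsilon_j+f(\xi^0+cS_j)-f(\xi^0)\right)\right\}1(h\ge0)+\left\{\sum_{j=1}^{\nu^-(-h)}\left(-\tilde\epsilon_j+f(\xi^0)-f(\xi^0-c\tilde S_j)\right)\right\}1(h<0),$$ $$\tilde\Lambda(h)=\left\{\sum_{j=1}^{\nu^+(h)}\left(\epsilon_j+\beta_u^0-f(\xi^0)\right)\right\}1(h\ge0)+\left\{\sum_{j=1}^{\nu^-(-h)}\left(-\tilde\epsilon_j+f(\xi^0)-\beta_l^0\right)\right\}1(h<0).$$ The argmin of these processes means the smallest minimizer. *)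

theory Defs
  imports "HOL-Probability.Probability"
begin

definition smooth_real :: "(real \<Rightarrow> real) \<Rightarrow> bool" where
  "smooth_real f \<longleftrightarrow> (\<forall>k x. (deriv ^^ k) f differentiable (at x))"

definition continuously_differentiable_near :: "(real \<Rightarrow> real) \<Rightarrow> real \<Rightarrow> bool" where
  "continuously_differentiable_near g a \<longleftrightarrow>
     (\<exists>U. open U \<and> a \<in> U \<and> g C1_differentiable_on U)"

text \<open>The mean squared error of the one-split stump with split point \<open>\<theta>\<close> and levels \<open>bl\<close>, \<open>bu\<close>,
  for the response \<open>Y = g X + eps\<close>.\<close>

definition stump_risk ::
  "'b measure \<Rightarrow> ('b \<Rightarrow> real) \<Rightarrow> ('b \<Rightarrow> real) \<Rightarrow> (real \<Rightarrow> real) \<Rightarrow> real \<times> real \<times> real \<Rightarrow> real" where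
  "stump_risk N X eps g = (\<lambda>(\<theta>, bl, bu). prob_space.expectation N (\<lambda>\<omega>.
     (g (X \<omega>) + eps \<omega> - bl * indicator {..\<theta>} (X \<omega>) - bu * indicator {\<theta><..} (X \<omega>))\<^sup>2))"

text \<open>Every finite sequence \<open>0 \<le> t\<^sub>0 \<le> \<dots> \<le> t\<^sub>k\<close> extends to an infinite monotone one, so the last
  conjunct is the usual independence of finitely many increments. Subtraction on \<open>nat\<close> does not
  truncate here, since the paths are nondecreasing. No one-sided continuity is imposed, so that the
  definition covers both the right- and the left-continuous version.\<close>

definition (in prob_space) poisson_process :: "real \<Rightarrow> (real \<Rightarrow> 'a \<Rightarrow> nat) \<Rightarrow> bool" where
  "poisson_process rate \<nu> \<longleftrightarrow>
     (\<forall>t\<ge>0. \<nu> t \<in> measurable M (count_space UNIV)) \<and>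
     (\<forall>\<omega>\<in>space M. \<nu> 0 \<omega> = 0 \<and> mono_on {0..} (\<lambda>t. \<nu> t \<omega>)) \<and>
     (\<forall>s t. 0 \<le> s \<and> s < t \<longrightarrow>
        distr M (count_space UNIV) (\<lambda>\<omega>. \<nu> t \<omega> - \<nu> s \<omega>) = measure_pmf (poisson_pmf (rate * (t - s)))) \<and>
     (\<forall>t :: nat \<Rightarrow> real. 0 \<le> t 0 \<and> mono t \<longrightarrow>
        indep_vars (\<lambda>_. count_space UNIV) (\<lambda>i \<omega>. \<nu> (t (Suc i)) \<omega> - \<nu> (t i) \<omega>) UNIV)"

definition rcll_path :: "(real \<Rightarrow> nat) \<Rightarrow> bool" where
  "rcll_path p \<longleftrightarrow> (\<forall>t\<ge>0. continuous (at_right t) p) \<and> (\<forall>t>0. \<exists>l. (p \<longlongrightarrow> l) (at_left t))"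

definition lcrl_path :: "(real \<Rightarrow> nat) \<Rightarrow> bool" where
  "lcrl_path p \<longleftrightarrow> (\<forall>t>0. continuous (at_left t) p) \<and> (\<forall>t\<ge>0. \<exists>l. (p \<longlongrightarrow> l) (at_right t))"

text \<open>For a left-continuous path the infimum is not attained; it is still the time of the \<open>j\<close>-th
  jump.\<close>

definition arrival :: "(real \<Rightarrow> 'a \<Rightarrow> nat) \<Rightarrow> nat \<Rightarrow> 'a \<Rightarrow> real" where
  "arrival \<nu> j \<omega> = Inf {t. 0 \<le> t \<and> j \<le> \<nu> t \<omega>}"

definition generated_events :: "'a measure \<Rightarrow> 'b measure \<Rightarrow> 'i set \<Rightarrow> ('i \<Rightarrow> 'a \<Rightarrow> 'b) \<Rightarrow> 'a set set" where
  "generated_events M K I Z =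
     sigma_sets (space M) (\<Union>i\<in>I. {Z i -` A \<inter> space M |A. A \<in> sets K})"

text \<open>An i.i.d. sequence, indexed from 1, with common law \<open>D\<close>.\<close>

definition (in prob_space) iid_sequence :: "real measure \<Rightarrow> (nat \<Rightarrow> 'a \<Rightarrow> real) \<Rightarrow> bool" where
  "iid_sequence D e \<longleftrightarrow>
     indep_vars (\<lambda>_. borel) e {1..} \<and> (\<forall>j\<ge>1. distr M borel (e j) = D)"

definition Lambda ::
  "(real \<Rightarrow> real) \<Rightarrow> real \<Rightarrow> (real \<Rightarrow> 'a \<Rightarrow> nat) \<Rightarrow> (real \<Rightarrow> 'a \<Rightarrow> nat) \<Rightarrow>
   (nat \<Rightarrow> 'a \<Rightarrow> real) \<Rightarrow> (nat \<Rightarrow> 'a \<Rightarrow> real) \<Rightarrow> real \<Rightarrow> 'a \<Rightarrow> real \<Rightarrow> real" where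
  "Lambda f \<xi>0 \<nu>p \<nu>m e e' c \<omega> h =
     (if h \<ge> 0
      then \<Sum>j=1..\<nu>p h \<omega>. (e j \<omega> + f (\<xi>0 + c * arrival \<nu>p j \<omega>) - f \<xi>0)
      else \<Sum>j=1..\<nu>m (- h) \<omega>. (- e' j \<omega> + f \<xi>0 - f (\<xi>0 - c * arrival \<nu>m j \<omega>)))"

definition Lambda_tilde ::
  "(real \<Rightarrow> real) \<Rightarrow> real \<Rightarrow> real \<Rightarrow> real \<Rightarrow> (real \<Rightarrow> 'a \<Rightarrow> nat) \<Rightarrow> (real \<Rightarrow> 'a \<Rightarrow> nat) \<Rightarrow>
   (nat \<Rightarrow> 'a \<Rightarrow> real) \<Rightarrow> (nat \<Rightarrow> 'a \<Rightarrow> real) \<Rightarrow> 'a \<Rightarrow> real \<Rightarrow> real" where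
  "Lambda_tilde f \<xi>0 \<beta>l \<beta>u \<nu>p \<nu>m e e' \<omega> h =
     (if h \<ge> 0
      then \<Sum>j=1..\<nu>p h \<omega>. (e j \<omega> + \<beta>u - f \<xi>0)
      else \<Sum>j=1..\<nu>m (- h) \<omega>. (- e' j \<omega> + f \<xi>0 - \<beta>l))"

text \<open>Arbitrary (but one fixed real number) if there is no smallest minimizer.\<close>

definition smallest_argmin :: "(real \<Rightarrow> real) \<Rightarrow> real" where
  "smallest_argmin g = (LEAST h. is_arg_min g (\<lambda>_. True) h)"

text \<open>The library's \<^const>\<open>weak_conv_m\<close>, which is about sequences of laws, along an arbitrary
  filter.\<close>

definition weak_conv_m_along :: "('c \<Rightarrow> real measure) \<Rightarrow> real measure \<Rightarrow> 'c filter \<Rightarrow> bool" where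
  "weak_conv_m_along \<mu> \<mu>0 F \<longleftrightarrow>
     (\<forall>x. isCont (cdf \<mu>0) x \<longrightarrow> ((\<lambda>c. cdf (\<mu> c) x) \<longlongrightarrow> cdf \<mu>0 x) F)"

lemma weak_conv_m_along_sequentially:
  "weak_conv_m_along \<mu> \<mu>0 sequentially \<longleftrightarrow> weak_conv_m \<mu> \<mu>0"
  by (simp add: weak_conv_m_along_def weak_conv_m_def weak_conv_def)

end

theory Submission
  imports Defs
begin

text \<open>Much more than convergence in law holds: for almost every \<open>\<omega>\<close> the smallest minimizers of
  \<open>\<Lambda>\<^sub>c\<close> and of \<open>\<Lambda>\<close>-tilde are the same number for all large \<open>c\<close>
  (\<open>eventually_smallest_argmin_Lambda_eq\<close>). Convergence of the distribution functions then follows by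
  dominated convergence, at every point.

  Both processes depend on \<open>h\<close> only through the signed number \<open>l\<close> of jumps between \<open>0\<close> and \<open>h\<close>, here
  called the level: each of them is a two-sided walk indexed by the integers, read at the level of \<open>h\<close>.
  The levels do not depend on \<open>c\<close>, so the two sets of minimizers coincide as soon as both walks have
  the same unique minimizing level. Three almost sure facts give this.

  First, the steps converge. The first arrival time is positive and every further one is at least as
  large, so that \<open>c S\<^sub>j\<close> tends to infinity, uniformly in \<open>j\<close>, and \<open>f (\<xi>\<^sub>0 + c S\<^sub>j)\<close> tends to \<open>\<beta>\<^sub>u\<close>; likewise on the
  left. Second, only finitely many levels compete. Since \<open>f'(\<xi>\<^sub>0) > 0\<close> and \<open>f\<close> is monotone,
  \<open>f \<xi>\<^sub>0\<close> lies strictly between \<open>\<beta>\<^sub>l\<close> and \<open>\<beta>\<^sub>u\<close>, so for large \<open>c\<close> all steps have a drift of at least half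
  the limiting one. By the strong law of large numbers the walks are then positive, hence worse than
  level \<open>0\<close>, beyond some level that depends on \<open>\<omega>\<close> but not on \<open>c\<close>
  (\<open>one_sided_walk_positive\<close>). Third, the limiting walk has no ties, because the errors have no
  atoms and are independent (\<open>AE_walk_inj\<close>). So the limiting walk has a unique minimizing level, and by
  the convergence at finitely many levels it is eventually also the unique minimizing level of the walk
  of \<open>\<Lambda>\<^sub>c\<close> (\<open>eventually_unique_minimizer\<close>).

  The laws in the statement are image measures, so the smallest minimizers must also be measurable.
  This rests on the one-sided continuity of the Poisson paths, which makes the processes locally constant
  to the right in \<open>h\<close>; rational arguments then suffice to detect minimizers, and a set of minimizers
  that is nonempty and bounded below contains its infimum (\<open>smallest_argmin_measurable\<close>).\<close>

section \<open>A strong law of large numbers for orthogonal sequences\<close>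

text \<open>The series of the \<open>Q n\<close> has finite expectation, so it converges almost surely and its terms vanish in
  the limit.\<close>

lemma AE_tendsto_0_if_summable_integral:
  fixes Q :: "nat \<Rightarrow> 'a \<Rightarrow> real"
  assumes int: "\<And>n. integrable M (Q n)" and nonneg: "\<And>n \<omega>. 0 \<le> Q n \<omega>"
    and le: "\<And>n. (\<integral>\<omega>. Q n \<omega> \<partial>M) \<le> b n" and b: "summable b"
  shows "AE \<omega> in M. (\<lambda>n. Q n \<omega>) \<longlonglongrightarrow> 0"
proof -
  note [measurable] = borel_measurable_integrable[OF int]
  have b0: "0 \<le> b n" for n
    using le[of n] integral_nonneg_AE[where M = M and f = "Q n"] nonneg by fastforce
  have "(\<integral>\<^sup>+\<omega>. (\<Sum>n. ennreal (Q n \<omega>)) \<partial>M) = (\<Sum>n. \<integral>\<^sup>+\<omega>. ennreal (Q n \<omega>) \<partial>M)"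
    by (rule nn_integral_suminf) measurable
  also have "\<dots> = (\<Sum>n. ennreal (\<integral>\<omega>. Q n \<omega> \<partial>M))"
    by (intro suminf_cong nn_integral_eq_integral int) (auto simp: nonneg)
  also have "\<dots> \<le> (\<Sum>n. ennreal (b n))"
    by (intro suminf_le ennreal_leI le) auto
  also have "\<dots> < \<infinity>"
    by (simp add: suminf_ennreal2[OF b0 b])
  finally have "AE \<omega> in M. (\<Sum>n. ennreal (Q n \<omega>)) \<noteq> \<infinity>"
    by (intro nn_integral_PInf_AE) auto
  then show ?thesis
  proof eventually_elim
    case (elim \<omega>)
    then have "summable (\<lambda>n. Q n \<omega>)"
      by (intro summable_suminf_not_top) (auto simp: nonneg)
    then show ?case by (rule summable_LIMSEQ_zero)
  qed
qed

text \<open>The mixed terms of the expanded square have integral zero.\<close>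

lemma integral_square_sum_orthogonal:
  fixes Z :: "nat \<Rightarrow> 'a \<Rightarrow> real" and v :: real
  assumes meas: "\<And>i. i \<in> I \<Longrightarrow> Z i \<in> borel_measurable M"
    and int: "\<And>i. i \<in> I \<Longrightarrow> integrable M (\<lambda>\<omega>. (Z i \<omega>)\<^sup>2)"
    and le: "\<And>i. i \<in> I \<Longrightarrow> (\<integral>\<omega>. (Z i \<omega>)\<^sup>2 \<partial>M) \<le> v"
    and orth: "\<And>i j. i \<in> I \<Longrightarrow> j \<in> I \<Longrightarrow> i \<noteq> j \<Longrightarrow> (\<integral>\<omega>. Z i \<omega> * Z j \<omega> \<partial>M) = 0"
    and fin: "finite J" "J \<subseteq> I"
  shows "integrable M (\<lambda>\<omega>. (\<Sum>i\<in>J. Z i \<omega>)\<^sup>2)" "(\<integral>\<omega>. (\<Sum>i\<in>J. Z i \<omega>)\<^sup>2 \<partial>M) \<le> card J * v"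
proof -
  have prod: "integrable M (\<lambda>\<omega>. Z i \<omega> * Z j \<omega>)" if "i \<in> I" "j \<in> I" for i j
  proof (rule Bochner_Integration.integrable_bound[where f = "\<lambda>\<omega>. (Z i \<omega>)\<^sup>2 + (Z j \<omega>)\<^sup>2"])
    show "(\<lambda>\<omega>. Z i \<omega> * Z j \<omega>) \<in> borel_measurable M"
      using meas[OF that(1)] meas[OF that(2)] by measurable
    show "AE \<omega> in M. norm (Z i \<omega> * Z j \<omega>) \<le> norm ((Z i \<omega>)\<^sup>2 + (Z j \<omega>)\<^sup>2)"
    proof (rule AE_I2)
      fix \<omega>
      have "2 * (\<bar>Z i \<omega>\<bar> * \<bar>Z j \<omega>\<bar>) \<le> (Z i \<omega>)\<^sup>2 + (Z j \<omega>)\<^sup>2"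
        using sum_squares_bound[of "\<bar>Z i \<omega>\<bar>" "\<bar>Z j \<omega>\<bar>"] by simp
      moreover have "0 \<le> \<bar>Z i \<omega>\<bar> * \<bar>Z j \<omega>\<bar>" by simp
      ultimately show "norm (Z i \<omega> * Z j \<omega>) \<le> norm ((Z i \<omega>)\<^sup>2 + (Z j \<omega>)\<^sup>2)"
        unfolding real_norm_def abs_mult by linarith
    qed
  qed (use int that in auto)
  have sq: "(\<Sum>i\<in>J. Z i \<omega>)\<^sup>2 = (\<Sum>i\<in>J. \<Sum>j\<in>J. Z i \<omega> * Z j \<omega>)" for \<omega>
    by (simp add: power2_eq_square sum_product)
  show "integrable M (\<lambda>\<omega>. (\<Sum>i\<in>J. Z i \<omega>)\<^sup>2)"
    unfolding sq using fin prod by (intro Bochner_Integration.integrable_sum) auto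
  have "(\<integral>\<omega>. (\<Sum>i\<in>J. Z i \<omega>)\<^sup>2 \<partial>M) = (\<Sum>i\<in>J. \<Sum>j\<in>J. \<integral>\<omega>. Z i \<omega> * Z j \<omega> \<partial>M)"
    unfolding sq using fin prod
    by (simp add: subset_iff Bochner_Integration.integral_sum)
  also have "\<dots> = (\<Sum>i\<in>J. \<Sum>j\<in>J. if i = j then \<integral>\<omega>. (Z i \<omega>)\<^sup>2 \<partial>M else 0)"
    using fin orth by (intro sum.cong refl) (auto simp: power2_eq_square)
  also have "\<dots> = (\<Sum>i\<in>J. \<integral>\<omega>. (Z i \<omega>)\<^sup>2 \<partial>M)"
    using fin by (simp add: sum.delta)
  also have "\<dots> \<le> card J * v"
    using fin le by (intro sum_bounded_above) auto
  finally show "(\<integral>\<omega>. (\<Sum>i\<in>J. Z i \<omega>)\<^sup>2 \<partial>M) \<le> card J * v" .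
qed

text \<open>Only second moments are available, so the averages are controlled along the squares \<open>n\<^sup>2\<close>, where
  the mean square \<open>v / n\<^sup>2\<close> is summable. Between two consecutive squares there are \<open>2 n + 1\<close> partial
  sums, and each differs from the one at \<open>n\<^sup>2\<close> by at most \<open>2 n\<close> terms; the sum of the squares of these
  differences is still of order \<open>n\<^sup>2\<close> in mean, which the division by \<open>n\<^sup>4\<close> makes summable.\<close>

lemma AE_average_tendsto_0_orthogonal:
  fixes Z :: "nat \<Rightarrow> 'a \<Rightarrow> real" and v :: real
  assumes meas: "\<And>i. i \<ge> 1 \<Longrightarrow> Z i \<in> borel_measurable M"
    and int: "\<And>i. i \<ge> 1 \<Longrightarrow> integrable M (\<lambda>\<omega>. (Z i \<omega>)\<^sup>2)"
    and le: "\<And>i. i \<ge> 1 \<Longrightarrow> (\<integral>\<omega>. (Z i \<omega>)\<^sup>2 \<partial>M) \<le> v"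
    and orth: "\<And>i j. i \<ge> 1 \<Longrightarrow> j \<ge> 1 \<Longrightarrow> i \<noteq> j \<Longrightarrow> (\<integral>\<omega>. Z i \<omega> * Z j \<omega> \<partial>M) = 0"
  shows "AE \<omega> in M. (\<lambda>k. (\<Sum>j=1..k. Z j \<omega>) / k) \<longlonglongrightarrow> 0"
proof -
  define Q where "Q n \<omega> = ((\<Sum>j=1..n\<^sup>2. Z j \<omega>)\<^sup>2
      + (\<Sum>k\<in>{n\<^sup>2..<(Suc n)\<^sup>2}. (\<Sum>j\<in>{n\<^sup>2<..k}. Z j \<omega>)\<^sup>2)) / (real n)^4" for n \<omega>
  have v0: "0 \<le> v"
    using order_trans[OF Bochner_Integration.integral_nonneg le[of 1]] by simp
  have meas': "\<And>i. i \<in> {1..} \<Longrightarrow> Z i \<in> borel_measurable M" using meas by auto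
  have sqi: "integrable M (\<lambda>\<omega>. (\<Sum>i\<in>J. Z i \<omega>)\<^sup>2)"
    and sqle: "(\<integral>\<omega>. (\<Sum>i\<in>J. Z i \<omega>)\<^sup>2 \<partial>M) \<le> card J * v" if "finite J" "J \<subseteq> {1..}" for J
    using integral_square_sum_orthogonal[OF meas' _ _ _ that, where v = v] int le orth by auto
  have Qint: "integrable M (Q n)" for n
    unfolding Q_def
    by (intro integrable_divide Bochner_Integration.integrable_add Bochner_Integration.integrable_sum sqi)
      auto
  \<comment> \<open>The bound is \<open>(n\<^sup>2 v + (2 n + 1)\<^sup>2 v) / n\<^sup>4\<close>, and \<open>n\<^sup>2 + (2 n + 1)\<^sup>2 \<le> 10 n\<^sup>2\<close> for \<open>n \<ge> 1\<close>.\<close>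
  have Qle: "(\<integral>\<omega>. Q n \<omega> \<partial>M) \<le> 10 * v * (1 / (real n)^2)" for n
  proof (cases "n = 0")
    case True then show ?thesis by (simp add: Q_def)
  next
    case False
    then have n: "1 \<le> real n" by simp
    have "(\<integral>\<omega>. Q n \<omega> \<partial>M) = ((\<integral>\<omega>. (\<Sum>j=1..n\<^sup>2. Z j \<omega>)\<^sup>2 \<partial>M)
      + (\<Sum>k\<in>{n\<^sup>2..<(Suc n)\<^sup>2}. \<integral>\<omega>. (\<Sum>j\<in>{n\<^sup>2<..k}. Z j \<omega>)\<^sup>2 \<partial>M)) / (real n)^4"
      unfolding Q_def
      by (subst integral_divide_zero, subst Bochner_Integration.integral_add)
        (auto intro!: Bochner_Integration.integrable_sum sqi Bochner_Integration.integral_sum)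
    also have "\<dots> \<le> (real (n\<^sup>2) * v + (\<Sum>k\<in>{n\<^sup>2..<(Suc n)\<^sup>2}. (2 * real n + 1) * v)) / (real n)^4"
    proof (intro divide_right_mono add_mono sum_mono)
      show "(\<integral>\<omega>. (\<Sum>j=1..n\<^sup>2. Z j \<omega>)\<^sup>2 \<partial>M) \<le> real (n\<^sup>2) * v"
        using sqle[of "{1..n\<^sup>2}"] by simp
      fix k assume k: "k \<in> {n\<^sup>2..<(Suc n)\<^sup>2}"
      have "(\<integral>\<omega>. (\<Sum>j\<in>{n\<^sup>2<..k}. Z j \<omega>)\<^sup>2 \<partial>M) \<le> real (k - n\<^sup>2) * v"
        using sqle[of "{n\<^sup>2<..k}"] by (simp add: subset_iff)
      also have "k - n\<^sup>2 \<le> 2 * n + 1"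
        using k by (auto simp: power2_eq_square)
      then have "real (k - n\<^sup>2) * v \<le> (2 * real n + 1) * v"
        using v0 by (intro mult_right_mono) (auto simp flip: of_nat_Suc of_nat_mult)
      finally show "(\<integral>\<omega>. (\<Sum>j\<in>{n\<^sup>2<..k}. Z j \<omega>)\<^sup>2 \<partial>M) \<le> (2 * real n + 1) * v" .
    qed simp
    also have "(\<Sum>k\<in>{n\<^sup>2..<(Suc n)\<^sup>2}. (2 * real n + 1) * v) = (2 * real n + 1)^2 * v"
      by (simp add: power2_eq_square algebra_simps)
    also have "real (n\<^sup>2) * v + (2 * real n + 1)^2 * v \<le> 10 * (real n)^2 * v"
    proof -
      have "real n \<le> (real n)^2" using n by (simp add: power2_eq_square)
      moreover have "real (n\<^sup>2) + (2 * real n + 1)^2 = 5 * (real n)^2 + 4 * real n + 1"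
        by (simp add: power2_sum power_mult_distrib)
      ultimately have "real (n\<^sup>2) + (2 * real n + 1)^2 \<le> 10 * (real n)^2"
        using n by linarith
      then show ?thesis using v0 by (metis mult_right_mono distrib_right)
    qed
    then have "(real (n\<^sup>2) * v + (2 * real n + 1)^2 * v) / (real n)^4 \<le> (10 * (real n)^2 * v) / (real n)^4"
      by (intro divide_right_mono) auto
    also have "(10 * (real n)^2 * v) / (real n)^4 = 10 * v * (1 / (real n)^2)"
      using n by (simp add: field_simps flip: power_add)
    finally show ?thesis .
  qed
  have "summable (\<lambda>n. 10 * v * (1 / (real n)^2))"
    by (intro summable_mult) (use inverse_power_summable[of 2, where 'a = real] in \<open>simp add: inverse_eq_divide\<close>)
  then have "AE \<omega> in M. (\<lambda>n. Q n \<omega>) \<longlonglongrightarrow> 0"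
    by (intro AE_tendsto_0_if_summable_integral[OF Qint _ Qle]) (auto simp: Q_def intro!: divide_nonneg_nonneg add_nonneg_nonneg sum_nonneg)
  then show ?thesis
  proof eventually_elim
    case (elim \<omega>)
    \<comment> \<open>The block of \<open>k\<close> is given by \<open>n = floor_sqrt k\<close>, and \<open>(T\<^sub>k / k)\<^sup>2 \<le> 2 Q\<^sub>n\<close> for the \<open>k\<close>-th partial sum \<open>T\<^sub>k\<close>.\<close>
    have "filterlim floor_sqrt at_top sequentially"
      unfolding filterlim_at_top
    proof
      fix m
      show "\<forall>\<^sub>F k in sequentially. m \<le> floor_sqrt k"
        using eventually_ge_at_top[of "m\<^sup>2"] by eventually_elim (simp add: le_floor_sqrt_iff)
    qed
    from filterlim_compose[OF elim this]
    have lim: "(\<lambda>k. sqrt (2 * Q (floor_sqrt k) \<omega>)) \<longlonglongrightarrow> 0"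
      by (auto intro!: tendsto_eq_intros)
    have "\<bar>(\<Sum>j=1..k. Z j \<omega>) / k\<bar> \<le> sqrt (2 * Q (floor_sqrt k) \<omega>)" if k: "k \<ge> 1" for k
    proof -
      define n where "n = floor_sqrt k"
      have n1: "n \<ge> 1" using k by (simp add: n_def le_floor_sqrt_iff)
      have nk: "n\<^sup>2 \<le> k" "k < (Suc n)\<^sup>2"
        by (simp_all add: n_def Suc_floor_sqrt_power2_gt)
      let ?a = "\<Sum>j=1..n\<^sup>2. Z j \<omega>" and ?b = "\<Sum>j\<in>{n\<^sup>2<..k}. Z j \<omega>"
      have "{1..k} = {1..n\<^sup>2} \<union> {n\<^sup>2<..k}" using nk by auto
      then have T: "(\<Sum>j=1..k. Z j \<omega>) = ?a + ?b"
        by (subst sum.union_disjoint[symmetric]) auto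
      have "?b\<^sup>2 \<le> (\<Sum>k\<in>{n\<^sup>2..<(Suc n)\<^sup>2}. (\<Sum>j\<in>{n\<^sup>2<..k}. Z j \<omega>)\<^sup>2)"
        using nk by (intro member_le_sum) auto
      then have "?a\<^sup>2 + ?b\<^sup>2 \<le> Q n \<omega> * (real n)^4"
        using n1 by (simp add: Q_def)
      moreover have "(?a + ?b)\<^sup>2 \<le> 2 * (?a\<^sup>2 + ?b\<^sup>2)"
        using sum_squares_bound[of ?a ?b] by (simp add: power2_sum)
      ultimately have "(?a + ?b)\<^sup>2 \<le> 2 * Q n \<omega> * ((real n)\<^sup>2)\<^sup>2"
        by simp
      then have "((?a + ?b) / (real n)\<^sup>2)\<^sup>2 \<le> 2 * Q n \<omega>"
        using n1 by (simp add: power_divide divide_simps)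
      then have "\<bar>(?a + ?b) / (real n)\<^sup>2\<bar> \<le> sqrt (2 * Q n \<omega>)"
        by (metis real_sqrt_abs real_sqrt_le_mono)
      moreover have "\<bar>(?a + ?b) / k\<bar> \<le> \<bar>(?a + ?b) / (real n)\<^sup>2\<bar>"
        using nk n1 k unfolding abs_divide
        by (intro divide_left_mono) (auto simp flip: of_nat_power)
      ultimately show ?thesis unfolding T n_def[symmetric] by linarith
    qed
    then show ?case
      by (intro Lim_null_comparison[OF _ lim] eventually_at_top_linorderI[of 1]) auto
  qed
qed

text \<open>Independence and mean zero make the sequence orthogonal, so that the strong law above applies.\<close>

lemma (in prob_space)
  assumes iid: "iid_sequence D Z"
    and D: "integrable D (\<lambda>x. x)" "(\<integral>x. x \<partial>D) = 0" "integrable D (\<lambda>x. x\<^sup>2)"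
  shows iid_sequence_measurable: "\<And>j. j \<ge> 1 \<Longrightarrow> Z j \<in> borel_measurable M"
    and iid_sequence_atomless: "(\<And>x. isCont (cdf D) x) \<Longrightarrow> j \<ge> 1 \<Longrightarrow> AE \<omega> in M. Z j \<omega> \<noteq> c"
    and iid_sequence_average_tendsto_0: "AE \<omega> in M. (\<lambda>k. (\<Sum>j=1..k. Z j \<omega>) / k) \<longlonglongrightarrow> 0"
proof -
  have ind: "indep_vars (\<lambda>_. borel) Z {1..}" and distr: "\<And>j. j \<ge> 1 \<Longrightarrow> distr M borel (Z j) = D"
    using iid by (auto simp: iid_sequence_def)
  show meas: "Z j \<in> borel_measurable M" if "j \<ge> 1" for j
    using ind that by (auto simp: indep_vars_def)
  show "AE \<omega> in M. Z j \<omega> \<noteq> c" if "\<And>x. isCont (cdf D) x" and j: "j \<ge> 1"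
  proof -
    interpret D: real_distribution D
      unfolding distr[OF j, symmetric] using meas[OF j] by (rule real_distribution_distr)
    have "AE x in D. x \<noteq> c"
      using that(1)[of c] D.isCont_cdf[of c] by (subst AE_iff_measurable[of "{c}"]) (auto simp: D.emeasure_eq_measure)
    then show ?thesis
      unfolding distr[OF j, symmetric] using meas[OF j] by (subst (asm) AE_distr_iff) auto
  qed
  show "AE \<omega> in M. (\<lambda>k. (\<Sum>j=1..k. Z j \<omega>) / k) \<longlonglongrightarrow> 0"
  proof (rule AE_average_tendsto_0_orthogonal[OF meas])
    have int: "integrable M (Z i)" and mean: "(\<integral>\<omega>. Z i \<omega> \<partial>M) = 0" if i: "i \<ge> 1" for i
      using D(1,2) meas[OF i] unfolding distr[OF i, symmetric]
      by (auto simp: integrable_distr_eq integral_distr)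
    show "integrable M (\<lambda>\<omega>. (Z i \<omega>)\<^sup>2)" "(\<integral>\<omega>. (Z i \<omega>)\<^sup>2 \<partial>M) \<le> (\<integral>x. x\<^sup>2 \<partial>D)" if i: "i \<ge> 1" for i
      using D(3) meas[OF i] unfolding distr[OF i, symmetric]
      by (auto simp: integrable_distr_eq integral_distr)
    show "(\<integral>\<omega>. Z i \<omega> * Z j \<omega> \<partial>M) = 0" if i: "i \<ge> 1" and j: "j \<ge> 1" and "i \<noteq> j" for i j
    proof -
      have "indep_var borel (Z i) borel (\<lambda>\<omega>. \<Sum>j\<in>{j}. Z j \<omega>)"
        using that by (intro indep_vars_sum indep_vars_subset[OF ind]) auto
      then have "indep_var borel (Z i) borel (Z j)" by simp
      from indep_var_lebesgue_integral[OF this int[OF i] int[OF j]] mean[OF i] show ?thesis by simp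
    qed
  qed
qed

section \<open>Independence and sums without atoms\<close>

text \<open>This extracts the independence of the two error sequences from the joint independence of the four
  families.\<close>

lemma (in prob_space) indep_set_if_indep_sets:
  assumes ind: "indep_sets F I" and ij: "i \<in> I" "j \<in> I" "i \<noteq> j"
  shows "indep_set (F i) (F j)"
  unfolding indep_sets2_eq
proof (intro conjI ballI)
  show "F i \<subseteq> events" "F j \<subseteq> events"
    using ind ij by (auto simp: indep_sets_def)
  fix a b assume "a \<in> F i" "b \<in> F j"
  then show "prob (a \<inter> b) = prob a * prob b"
    using indep_setsD[OF ind, of "{i, j}" "\<lambda>k. if k = i then a else b"] ij by (simp add: Int_commute)
qed

lemma sum_measurable_generated_events:
  fixes Z :: "'i \<Rightarrow> 'a \<Rightarrow> real"
  assumes "J \<subseteq> I"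
  shows "{(\<lambda>\<omega>. \<Sum>j\<in>J. Z j \<omega>) -` A \<inter> space M |A. A \<in> sets borel} \<subseteq> generated_events M borel I Z"
proof -
  let ?G = "\<Union>i\<in>I. {Z i -` A \<inter> space M |A. A \<in> sets borel}"
  have sets: "sets (sigma (space M) ?G) = sigma_sets (space M) ?G"
    by (rule sets_measure_of) auto
  have "Z j \<in> borel_measurable (sigma (space M) ?G)" if "j \<in> J" for j
    using that assms by (intro measurableI) (auto simp: sets space_measure_of_conv intro!: sigma_sets.Basic)
  then have "(\<lambda>\<omega>. \<Sum>j\<in>J. Z j \<omega>) \<in> borel_measurable (sigma (space M) ?G)"
    by (rule borel_measurable_sum)
  from measurable_sets[OF this] show ?thesis
    by (auto simp: generated_events_def sets space_measure_of_conv)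
qed

lemma (in prob_space) indep_var_sums_if_indep_generated_events:
  fixes Z Z' :: "'i \<Rightarrow> 'a \<Rightarrow> real"
  assumes ind: "indep_set (generated_events M borel I Z) (generated_events M borel I Z')"
    and J: "J \<subseteq> I" "J' \<subseteq> I"
    and meas: "\<And>j. j \<in> I \<Longrightarrow> Z j \<in> borel_measurable M" "\<And>j. j \<in> I \<Longrightarrow> Z' j \<in> borel_measurable M"
  shows "indep_var borel (\<lambda>\<omega>. \<Sum>j\<in>J. Z j \<omega>) borel (\<lambda>\<omega>. \<Sum>j\<in>J'. Z' j \<omega>)"
proof -
  have sub: "sigma_sets (space M) {(\<lambda>\<omega>. \<Sum>j\<in>J. Z j \<omega>) -` A \<inter> space M |A. A \<in> sets borel}
      \<subseteq> generated_events M borel I Z" if "J \<subseteq> I" for J and Z :: "'i \<Rightarrow> 'a \<Rightarrow> real"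
    using sum_measurable_generated_events[OF that, of Z M] unfolding generated_events_def
    by (rule sigma_sets_mono)
  have "(\<lambda>\<omega>. \<Sum>j\<in>J. Z j \<omega>) \<in> borel_measurable M" "(\<lambda>\<omega>. \<Sum>j\<in>J'. Z' j \<omega>) \<in> borel_measurable M"
    using J meas by (auto intro!: borel_measurable_sum)
  moreover have "indep_set
      (sigma_sets (space M) {(\<lambda>\<omega>. \<Sum>j\<in>J. Z j \<omega>) -` A \<inter> space M |A. A \<in> sets borel})
      (sigma_sets (space M) {(\<lambda>\<omega>. \<Sum>j\<in>J'. Z' j \<omega>) -` A \<inter> space M |A. A \<in> sets borel})"
    using ind sub[OF J(1), of Z] sub[OF J(2), of Z'] unfolding indep_sets2_eq by blast
  ultimately show ?thesis by (simp add: indep_var_eq)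
qed

text \<open>By Fubini: given \<open>Y\<close>, the event asks \<open>X\<close> to hit one prescribed value.\<close>

lemma (in prob_space) AE_indep_add_neq:
  fixes X Y :: "'a \<Rightarrow> real"
  assumes ind: "indep_var borel X borel Y" and X: "\<And>c. AE \<omega> in M. X \<omega> \<noteq> c"
  shows "AE \<omega> in M. X \<omega> + Y \<omega> \<noteq> c"
proof -
  have [measurable]: "X \<in> borel_measurable M" "Y \<in> borel_measurable M"
    using indep_var_rv1[OF ind] indep_var_rv2[OF ind] by auto
  have joint: "distr M borel X \<Otimes>\<^sub>M distr M borel Y = distr M (borel \<Otimes>\<^sub>M borel) (\<lambda>\<omega>. (X \<omega>, Y \<omega>))"
    using ind by (simp add: indep_var_distribution_eq)
  interpret X: prob_space "distr M borel X" by (rule prob_space_distr) simp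
  interpret Y: prob_space "distr M borel Y" by (rule prob_space_distr) simp
  interpret XY: pair_sigma_finite "distr M borel Y" "distr M borel X" ..
  have "AE x in distr M borel X. x \<noteq> c - y" for y
    using X[of "c - y"] by (subst AE_distr_iff) auto
  then have ae: "AE z in distr M borel Y \<Otimes>\<^sub>M distr M borel X. snd z \<noteq> c - fst z"
  proof (intro XY.AE_pair_measure)
    have "{z \<in> space (borel \<Otimes>\<^sub>M borel). snd z \<noteq> c - fst z} \<in> sets (borel \<Otimes>\<^sub>M borel)"
      by measurable
    then show "{z \<in> space (distr M borel Y \<Otimes>\<^sub>M distr M borel X). snd z \<noteq> c - fst z}
        \<in> sets (distr M borel Y \<Otimes>\<^sub>M distr M borel X)"
      by (simp add: space_pair_measure cong: sets_pair_measure_cong)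
  qed simp
  have joint': "distr M borel Y \<Otimes>\<^sub>M distr M borel X = distr M (borel \<Otimes>\<^sub>M borel) (\<lambda>\<omega>. (Y \<omega>, X \<omega>))"
  proof -
    have "distr M borel Y \<Otimes>\<^sub>M distr M borel X =
        distr (distr M borel X \<Otimes>\<^sub>M distr M borel Y) (distr M borel Y \<Otimes>\<^sub>M distr M borel X) (\<lambda>(x, y). (y, x))"
      by (rule XY.distr_pair_swap)
    also have "\<dots> = distr (distr M (borel \<Otimes>\<^sub>M borel) (\<lambda>\<omega>. (X \<omega>, Y \<omega>))) (borel \<Otimes>\<^sub>M borel) (\<lambda>(x, y). (y, x))"
      unfolding joint by (intro distr_cong) (auto cong: sets_pair_measure_cong)
    finally show ?thesis
      by (subst (asm) distr_distr) (auto simp: comp_def)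
  qed
  from ae have "AE z in distr M (borel \<Otimes>\<^sub>M borel) (\<lambda>\<omega>. (Y \<omega>, X \<omega>)). snd z \<noteq> c - fst z"
    unfolding joint' .
  then have "AE \<omega> in M. X \<omega> \<noteq> c - Y \<omega>"
    by (subst (asm) AE_distr_iff) auto
  then show ?thesis
    by eventually_elim auto
qed

text \<open>One summand without atoms is enough, by conditioning on the others.\<close>

lemma (in prob_space) AE_indep_sum_neq:
  fixes Z :: "nat \<Rightarrow> 'a \<Rightarrow> real"
  assumes ind: "indep_vars (\<lambda>_. borel) Z I" and atomless: "\<And>i c. i \<in> I \<Longrightarrow> AE \<omega> in M. Z i \<omega> \<noteq> c"
    and J: "finite J" "J \<subseteq> I" "J \<noteq> {}"
  shows "AE \<omega> in M. (\<Sum>i\<in>J. Z i \<omega>) \<noteq> c"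
proof -
  obtain i where i: "i \<in> J" using J by auto
  have "indep_var borel (Z i) borel (\<lambda>\<omega>. \<Sum>j\<in>J - {i}. Z j \<omega>)"
    using J i by (intro indep_vars_sum indep_vars_subset[OF ind]) auto
  from AE_indep_add_neq[OF this, of c] have "AE \<omega> in M. Z i \<omega> + (\<Sum>j\<in>J - {i}. Z j \<omega>) \<noteq> c"
    using atomless J i by auto
  moreover have "(\<Sum>j\<in>J. Z j \<omega>) = Z i \<omega> + (\<Sum>j\<in>J - {i}. Z j \<omega>)" for \<omega>
    by (rule sum.remove[OF J(1) i])
  ultimately show ?thesis by simp
qed

section \<open>Minimizers of converging functions of a level\<close>

text \<open>The index \<open>b\<close> is a competitor that beats everything outside the finite set \<open>K\<close>, so both
  minimizations take place in \<open>K\<close>. There \<open>w0\<close> has a strict minimum, being injective, and strict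
  inequalities at finitely many points survive a small perturbation.\<close>

lemma eventually_unique_minimizer:
  fixes w :: "'c \<Rightarrow> 'l \<Rightarrow> real" and w0 :: "'l \<Rightarrow> real"
  assumes K: "finite K" "K \<subseteq> R" "b \<in> K"
    and outside: "\<forall>\<^sub>F c in F. \<forall>l\<in>R - K. w c b < w c l" "\<forall>l\<in>R - K. w0 b < w0 l"
    and lim: "\<And>l. l \<in> K \<Longrightarrow> ((\<lambda>c. w c l) \<longlongrightarrow> w0 l) F"
    and inj: "inj_on w0 K"
  obtains k where "k \<in> R" "\<forall>l\<in>R - {k}. w0 k < w0 l" "\<forall>\<^sub>F c in F. \<forall>l\<in>R - {k}. w c k < w c l"
proof -
  obtain k where k: "k \<in> K" "\<And>l. l \<in> K \<Longrightarrow> w0 k \<le> w0 l"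
    using K ex_is_arg_min_if_finite[of K w0] by (auto simp: is_arg_min_linorder)
  have less: "w0 k < w0 l" if "l \<in> K - {k}" for l
    using k that inj by (metis DiffD1 DiffD2 inj_on_def insertI1 order_le_less)
  have "\<forall>\<^sub>F c in F. \<forall>l\<in>K - {k}. w c k < w c l"
  proof (rule eventually_ball_finite)
    show "\<forall>l\<in>K - {k}. \<forall>\<^sub>F c in F. w c k < w c l"
    proof
      fix l assume l: "l \<in> K - {k}"
      have "((\<lambda>c. w c l - w c k) \<longlongrightarrow> w0 l - w0 k) F"
        using l k by (intro tendsto_diff lim) auto
      from order_tendstoD(1)[OF this, of 0] less[OF l] show "\<forall>\<^sub>F c in F. w c k < w c l"
        by simp
    qed
  qed (use K in auto)
  with outside(1) have "\<forall>\<^sub>F c in F. \<forall>l\<in>R - {k}. w c k < w c l"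
  proof eventually_elim
    case (elim c)
    have "w c k \<le> w c b"
      using elim(2) K(3) by (cases "b = k") (auto intro: less_imp_le)
    then show ?case
      using elim by (metis DiffI DiffD1 DiffD2 order_le_less_trans)
  qed
  moreover have "\<forall>l\<in>R - {k}. w0 k < w0 l"
    using outside(2) less k(2)[OF K(3)]
    by (metis DiffI DiffD1 DiffD2 order_le_less_trans)
  ultimately show ?thesis
    using that[of k] k K by blast
qed

text \<open>Once both functions of the level have the same unique minimizer \<open>k\<close>, their minimizers as functions
  of \<open>h\<close> form the same set, the points at level \<open>k\<close>. The smallest one is then the same as well, even
  if it is the default value because the set is unbounded below.\<close>

lemma eventually_smallest_argmin_eq:
  fixes level :: "real \<Rightarrow> 'l" and w :: "'c \<Rightarrow> 'l \<Rightarrow> real" and w0 :: "'l \<Rightarrow> real"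
  assumes "finite K" "K \<subseteq> range level" "b \<in> K"
    and "\<forall>\<^sub>F c in F. \<forall>l\<in>range level - K. w c b < w c l" "\<forall>l\<in>range level - K. w0 b < w0 l"
    and "\<And>l. l \<in> K \<Longrightarrow> ((\<lambda>c. w c l) \<longlongrightarrow> w0 l) F"
    and "inj_on w0 K"
  shows "\<forall>\<^sub>F c in F. smallest_argmin (\<lambda>h. w c (level h)) = smallest_argmin (\<lambda>h. w0 (level h))"
proof -
  obtain k where k: "k \<in> range level" "\<forall>l\<in>range level - {k}. w0 k < w0 l"
      "\<forall>\<^sub>F c in F. \<forall>l\<in>range level - {k}. w c k < w c l"
    using eventually_unique_minimizer[OF assms] .
  have argmin: "is_arg_min (\<lambda>h. v (level h)) (\<lambda>_. True) h \<longleftrightarrow> level h = k"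
    if "\<forall>l\<in>range level - {k}. v k < v l" for v :: "'l \<Rightarrow> real" and h
  proof
    assume h: "is_arg_min (\<lambda>h. v (level h)) (\<lambda>_. True) h"
    show "level h = k"
    proof (rule ccontr)
      assume "level h \<noteq> k"
      then have "v k < v (level h)" using that by auto
      with h k(1) show False by (auto simp: is_arg_min_def)
    qed
  next
    assume "level h = k"
    then have "v (level h) \<le> v (level h')" for h'
      using that by (cases "level h' = k") (auto intro: less_imp_le)
    then show "is_arg_min (\<lambda>h. v (level h)) (\<lambda>_. True) h"
      by (simp add: is_arg_min_linorder)
  qed
  from k(3) show ?thesis
    by eventually_elim (simp add: smallest_argmin_def argmin k(2))
qed

section \<open>Measurability of the smallest minimizer\<close>

text \<open>Local constancy to the right has two consequences. A minimizer can be recognised by comparison with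
  rational points only, and there is one in \<open>{..x}\<close> iff \<open>x\<close> itself or a rational point below \<open>x\<close> is one;
  hence that event is measurable. Moreover the infimum of the minimizers is a minimizer, if it is finite.
  So the smallest minimizer exists iff minimizers exist and are bounded below, which is a measurable
  event too; outside this event the value is the constant \<open>D\<close>.\<close>

lemma smallest_argmin_measurable:
  fixes G :: "real \<Rightarrow> 'a \<Rightarrow> real"
  assumes meas [measurable]: "\<And>h. G h \<in> borel_measurable M"
    and step: "\<And>\<omega> h. \<omega> \<in> space M \<Longrightarrow> \<forall>\<^sub>F h' in at_right h. G h' \<omega> = G h \<omega>"
  shows "(\<lambda>\<omega>. smallest_argmin (\<lambda>h. G h \<omega>)) \<in> borel_measurable M"
proof -
  define minim where "minim h \<omega> \<longleftrightarrow> is_arg_min (\<lambda>h. G h \<omega>) (\<lambda>_. True) h" for h \<omega>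
  \<comment> \<open>\<open>LEAST\<close> unfolds to the same description \<open>THE x. False\<close> for all predicates without a least element.\<close>
  define D :: real where "D = (LEAST h. False)"
  define B where "B x \<omega> \<longleftrightarrow> (\<exists>h\<le>x. minim h \<omega>)" for x \<omega>
  define least where "least \<omega> \<longleftrightarrow> (\<exists>n::nat. B (real n) \<omega>) \<and> (\<exists>n::nat. \<not> B (- real n) \<omega>)" for \<omega>
  have rational: "\<exists>q\<in>\<rat>. h < q \<and> q < x \<and> G q \<omega> = G h \<omega>" if \<omega>: "\<omega> \<in> space M" and "h < x" for \<omega> h x
  proof -
    obtain y where "y > h" "\<And>z. h < z \<Longrightarrow> z < y \<Longrightarrow> G z \<omega> = G h \<omega>"
      using step[OF \<omega>, of h] by (auto simp: eventually_at_right_field)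
    then show ?thesis
      using Rats_dense_in_real[of h "min x y"] \<open>h < x\<close> by auto
  qed
  have minim_rat: "minim h \<omega> \<longleftrightarrow> (\<forall>q\<in>\<rat>. G h \<omega> \<le> G q \<omega>)" if "\<omega> \<in> space M" for h \<omega>
  proof -
    have "G h \<omega> \<le> G y \<omega>" if "\<forall>q\<in>\<rat>. G h \<omega> \<le> G q \<omega>" for y
      using rational[OF \<open>\<omega> \<in> space M\<close>, of y "y + 1"] that by auto
    then show ?thesis unfolding minim_def is_arg_min_linorder by auto
  qed
  have minim_cong: "minim h \<omega> \<longleftrightarrow> minim h' \<omega>" if "G h \<omega> = G h' \<omega>" for h h' \<omega>
    using that by (simp add: minim_def is_arg_min_def)
  have B_rat: "B x \<omega> \<longleftrightarrow> (\<exists>q\<in>insert x {q\<in>\<rat>. q < x}. \<forall>r\<in>\<rat>. G q \<omega> \<le> G r \<omega>)" if \<omega>: "\<omega> \<in> space M" for x \<omega>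
  proof -
    have "B x \<omega> \<longleftrightarrow> (\<exists>q\<in>insert x {q\<in>\<rat>. q < x}. minim q \<omega>)"
    proof
      assume "B x \<omega>"
      then obtain h where h: "h \<le> x" "minim h \<omega>" by (auto simp: B_def)
      show "\<exists>q\<in>insert x {q\<in>\<rat>. q < x}. minim q \<omega>"
      proof (cases "h = x")
        case False
        then obtain q where "q \<in> \<rat>" "q < x" "G q \<omega> = G h \<omega>"
          using rational[OF \<omega>, of h x] h by auto
        with h minim_cong[of h \<omega> q] show ?thesis by auto
      qed (use h in auto)
    next
      assume "\<exists>q\<in>insert x {q\<in>\<rat>. q < x}. minim q \<omega>"
      then obtain q where "q \<le> x" "minim q \<omega>" by (auto dest: less_imp_le)
      then show "B x \<omega>" by (auto simp: B_def)
    qed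
    then show ?thesis using minim_rat[OF \<omega>] by simp
  qed
  have countable: "countable \<rat>" "countable (insert x {q\<in>\<rat>. q < x})" for x :: real
    using countable_rat by (auto intro: countable_subset[OF _ countable_rat])
  have B_meas [measurable]: "Measurable.pred M (B x)" for x
    by (subst measurable_cong[OF B_rat], assumption) (use countable in measurable)
  have least_meas [measurable]: "Measurable.pred M least"
    unfolding least_def by measurable
  have no_least: "smallest_argmin (\<lambda>h. G h \<omega>) = D" if "\<not> least \<omega>" for \<omega>
  proof -
    have "\<not> (minim h \<omega> \<and> (\<forall>h'. minim h' \<omega> \<longrightarrow> h \<le> h'))" for h
    proof
      assume h: "minim h \<omega> \<and> (\<forall>h'. minim h' \<omega> \<longrightarrow> h \<le> h')"
      obtain n m :: nat where "h \<le> real n" "- h < real m"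
        using real_arch_simple reals_Archimedean2 by metis
      then have "B (real n) \<omega>" "\<not> B (- real m) \<omega>"
        using h by (auto simp: B_def intro: order_trans)
      with that show False by (auto simp: least_def)
    qed
    then have none: "(minim h \<omega> \<and> (\<forall>h'. minim h' \<omega> \<longrightarrow> h \<le> h')) = False" for h
      by blast
    have "smallest_argmin (\<lambda>h. G h \<omega>) = (THE h. minim h \<omega> \<and> (\<forall>h'. minim h' \<omega> \<longrightarrow> h \<le> h'))"
      unfolding smallest_argmin_def Least_def minim_def ..
    also have "\<dots> = D"
      unfolding none D_def Least_def by (simp only: simp_thms)
    finally show ?thesis .
  qed
  have is_least: "smallest_argmin (\<lambda>h. G h \<omega>) \<le> x \<longleftrightarrow> B x \<omega>" if \<omega>: "\<omega> \<in> space M" and "least \<omega>" for \<omega> x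
  proof -
    obtain n m :: nat where n: "B (real n) \<omega>" and m: "\<not> B (- real m) \<omega>"
      using \<open>least \<omega>\<close> by (auto simp: least_def)
    define A where "A = {h. minim h \<omega>}"
    have ne: "A \<noteq> {}" using n by (auto simp: A_def B_def)
    have bdd: "bdd_below A"
    proof (rule bdd_belowI)
      fix h assume "h \<in> A"
      with m show "- real m \<le> h" using linear[of h "- real m"] by (auto simp: A_def B_def)
    qed
    have "minim (Inf A) \<omega>"
    proof -
      obtain y where y: "y > Inf A" "\<And>z. Inf A < z \<Longrightarrow> z < y \<Longrightarrow> G z \<omega> = G (Inf A) \<omega>"
        using step[OF \<omega>, of "Inf A"] by (auto simp: eventually_at_right_field)
      obtain z where z: "z \<in> A" "z < y"
        using y(1) cInf_less_iff[OF ne bdd] by auto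
      have "G z \<omega> = G (Inf A) \<omega>"
        using y(2)[of z] z cInf_lower[OF z(1) bdd] by (cases "z = Inf A") auto
      then have "minim z \<omega> \<longleftrightarrow> minim (Inf A) \<omega>" by (rule minim_cong)
      with z show ?thesis by (simp add: A_def)
    qed
    then have "smallest_argmin (\<lambda>h. G h \<omega>) = Inf A"
      unfolding smallest_argmin_def minim_def[symmetric]
      by (rule Least_equality) (auto simp: A_def intro!: cInf_lower bdd[unfolded A_def])
    moreover have "Inf A \<le> x \<longleftrightarrow> B x \<omega>"
    proof
      assume "B x \<omega>"
      then obtain h where "h \<le> x" "h \<in> A" by (auto simp: B_def A_def)
      with cInf_lower[OF _ bdd, of h] show "Inf A \<le> x" by simp
    next
      assume "Inf A \<le> x"
      with \<open>minim (Inf A) \<omega>\<close> show "B x \<omega>" by (auto simp: B_def)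
    qed
    ultimately show ?thesis by simp
  qed
  show ?thesis
  proof (rule borel_measurableI_le)
    fix x
    have "(smallest_argmin (\<lambda>h. G h \<omega>) \<le> x) = (if least \<omega> then B x \<omega> else D \<le> x)" if "\<omega> \<in> space M" for \<omega>
      using is_least[OF that] no_least by auto
    then have "{\<omega> \<in> space M. smallest_argmin (\<lambda>h. G h \<omega>) \<le> x} = {\<omega> \<in> space M. if least \<omega> then B x \<omega> else D \<le> x}"
      by auto
    also have "\<dots> \<in> sets M" by measurable
    finally show "{\<omega> \<in> space M. smallest_argmin (\<lambda>h. G h \<omega>) \<le> x} \<in> sets M" .
  qed
qed

section \<open>Almost sure eventual equality and convergence in law\<close>

text \<open>Along any sequence tending to infinity the indicator of \<open>X c \<le> x\<close> is almost surely eventually that of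
  \<open>Y \<le> x\<close>, so dominated convergence gives the limit of the distribution functions.\<close>

lemma weak_conv_m_along_if_AE_eventually_eq:
  fixes X :: "real \<Rightarrow> 'a \<Rightarrow> real" and Y :: "'a \<Rightarrow> real"
  assumes "prob_space M" and X [measurable]: "\<And>c. X c \<in> borel_measurable M" and Y [measurable]: "Y \<in> borel_measurable M"
    and eq: "AE \<omega> in M. \<forall>\<^sub>F c in at_top. X c \<omega> = Y \<omega>"
  shows "weak_conv_m_along (\<lambda>c. distr M borel (X c)) (distr M borel Y) at_top"
  unfolding weak_conv_m_along_def
proof (intro allI impI tendsto_at_topI_sequentially)
  interpret prob_space M by fact
  fix x and c :: "nat \<Rightarrow> real" assume c: "filterlim c at_top sequentially"
  have cdf: "cdf (distr M borel Z) x = (\<integral>\<omega>. indicator {..x} (Z \<omega>) \<partial>M)" if [measurable]: "Z \<in> borel_measurable M" for Z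
    by (simp add: cdf_def integral_distr[symmetric, where N = borel])
  have "(\<lambda>n. \<integral>\<omega>. indicator {..x} (X (c n) \<omega>) \<partial>M) \<longlonglongrightarrow> (\<integral>\<omega>. indicator {..x} (Y \<omega>) \<partial>M :: real)"
  proof (rule integral_dominated_convergence[where w = "\<lambda>_. 1"])
    show "AE \<omega> in M. (\<lambda>n. indicator {..x} (X (c n) \<omega>)) \<longlonglongrightarrow> (indicator {..x} (Y \<omega>) :: real)"
      using eq
    proof eventually_elim
      case (elim \<omega>)
      then have "\<forall>\<^sub>F n in sequentially. X (c n) \<omega> = Y \<omega>"
        using c by (rule eventually_compose_filterlim)
      then have "\<forall>\<^sub>F n in sequentially. indicator {..x} (X (c n) \<omega>) = (indicator {..x} (Y \<omega>) :: real)"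
        by eventually_elim simp
      then show ?case by (rule tendsto_eventually)
    qed
  qed auto
  then show "(\<lambda>n. cdf (distr M borel (X (c n))) x) \<longlonglongrightarrow> cdf (distr M borel Y) x"
    by (simp add: cdf)
qed

section \<open>The processes as walks read at a level\<close>

text \<open>Level \<open>0\<close> belongs to both sides: the processes vanish both before the first jump on the right and before
  the first one on the left, so these two stretches must not count as a tie.\<close>

definition level :: "(real \<Rightarrow> 'a \<Rightarrow> nat) \<Rightarrow> (real \<Rightarrow> 'a \<Rightarrow> nat) \<Rightarrow> 'a \<Rightarrow> real \<Rightarrow> int" where
  "level \<nu> \<nu>' \<omega> h = (if h \<ge> 0 then int (\<nu> h \<omega>) else - int (\<nu>' (- h) \<omega>))"

definition walk :: "(nat \<Rightarrow> real) \<Rightarrow> (nat \<Rightarrow> real) \<Rightarrow> int \<Rightarrow> real" where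
  "walk d d' l = (if l \<ge> 0 then \<Sum>j=1..nat l. d j else \<Sum>j=1..nat (- l). d' j)"

lemma walk_level:
  "walk d d' (level \<nu> \<nu>' \<omega> h) =
     (if h \<ge> 0 then \<Sum>j=1..\<nu> h \<omega>. d j else \<Sum>j=1..\<nu>' (- h) \<omega>. d' j)"
  by (auto simp: walk_def level_def)

lemma Lambda_eq_walk:
  "Lambda f \<xi>0 \<nu> \<nu>' e e' c \<omega> h =
     walk (\<lambda>j. e j \<omega> + (f (\<xi>0 + c * arrival \<nu> j \<omega>) - f \<xi>0))
       (\<lambda>j. - e' j \<omega> + (f \<xi>0 - f (\<xi>0 - c * arrival \<nu>' j \<omega>))) (level \<nu> \<nu>' \<omega> h)"
  by (simp add: walk_level Lambda_def algebra_simps)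

lemma Lambda_tilde_eq_walk:
  "Lambda_tilde f \<xi>0 \<beta>l \<beta>u \<nu> \<nu>' e e' \<omega> h =
     walk (\<lambda>j. e j \<omega> + (\<beta>u - f \<xi>0)) (\<lambda>j. - e' j \<omega> + (f \<xi>0 - \<beta>l)) (level \<nu> \<nu>' \<omega> h)"
  by (simp add: walk_level Lambda_tilde_def algebra_simps)

text \<open>A counting path with a one-sided limit equal to its value is constant on that side, since the natural
  numbers are discrete. On the left of \<open>0\<close> the path \<open>\<nu>'\<close> is read at \<open>- h\<close>, so that its left-continuity becomes
  constancy to the right of \<open>h\<close>.\<close>

lemma eventually_level_at_right:
  assumes r: "rcll_path (\<lambda>t. \<nu> t \<omega>)" and l: "lcrl_path (\<lambda>t. \<nu>' t \<omega>)"
  shows "\<forall>\<^sub>F h' in at_right h. level \<nu> \<nu>' \<omega> h' = level \<nu> \<nu>' \<omega> h"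
proof (cases "h \<ge> 0")
  case True
  then have "((\<lambda>t. \<nu> t \<omega>) \<longlongrightarrow> \<nu> h \<omega>) (at_right h)"
    using r by (simp add: rcll_path_def continuous_within)
  then have "\<forall>\<^sub>F h' in at_right h. \<nu> h' \<omega> = \<nu> h \<omega>"
    by (simp add: tendsto_discrete)
  with eventually_at_right_less[of h] show ?thesis
    by eventually_elim (use True in \<open>simp add: level_def\<close>)
next
  case False
  then have "((\<lambda>t. \<nu>' t \<omega>) \<longlongrightarrow> \<nu>' (- h) \<omega>) (at_left (- h))"
    using l by (simp add: lcrl_path_def continuous_within)
  then have "\<forall>\<^sub>F h' in at_right h. \<nu>' (- h') \<omega> = \<nu>' (- h) \<omega>"
    by (simp add: tendsto_discrete at_left_minus eventually_filtermap)
  moreover have "\<forall>\<^sub>F h' in at_right h. h' < 0"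
    using False by (intro eventually_at_rightI[of h 0]) auto
  ultimately show ?thesis
    by eventually_elim (use False in \<open>simp add: level_def\<close>)
qed

text \<open>The number of summands is random, but takes only countably many values.\<close>

lemma walk_level_measurable:
  assumes \<nu>: "\<And>t. t \<ge> 0 \<Longrightarrow> \<nu> t \<in> measurable M (count_space UNIV)"
    and \<nu>': "\<And>t. t \<ge> 0 \<Longrightarrow> \<nu>' t \<in> measurable M (count_space UNIV)"
    and d: "\<And>j. j \<ge> 1 \<Longrightarrow> d j \<in> borel_measurable M" "\<And>j. j \<ge> 1 \<Longrightarrow> d' j \<in> borel_measurable M"
  shows "(\<lambda>\<omega>. walk (\<lambda>j. d j \<omega>) (\<lambda>j. d' j \<omega>) (level \<nu> \<nu>' \<omega> h)) \<in> borel_measurable M"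
proof (cases "h \<ge> 0")
  case True
  then show ?thesis
    unfolding walk_level
    using measurable_compose_countable[of "\<lambda>n \<omega>. \<Sum>j=1..n. d j \<omega>" M borel "\<nu> h"] d \<nu> by auto
next
  case False
  then show ?thesis
    unfolding walk_level
    using measurable_compose_countable[of "\<lambda>n \<omega>. \<Sum>j=1..n. d' j \<omega>" M borel "\<nu>' (- h)"] d \<nu>' by auto
qed

section \<open>Arrival times\<close>

text \<open>The times \<open>t\<close> with \<open>j \<le> \<nu> t \<omega>\<close> form an upward closed set, so its infimum is below \<open>x\<close> iff it contains a
  rational point below \<open>x\<close>. If it is empty, the arrival time is the default value \<open>Inf {}\<close>.\<close>

lemma arrival_measurable:
  assumes meas: "\<And>t. t \<ge> 0 \<Longrightarrow> \<nu> t \<in> measurable M (count_space UNIV)"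
    and mono: "\<And>\<omega>. \<omega> \<in> space M \<Longrightarrow> mono_on {0..} (\<lambda>t. \<nu> t \<omega>)"
  shows "arrival \<nu> j \<in> borel_measurable M"
proof (rule borel_measurableI_less)
  fix x :: real
  \<comment> \<open>The paths are constrained at nonnegative times only; \<open>max 0 t\<close> removes the side condition.\<close>
  have [measurable]: "\<nu> (max 0 t) \<in> measurable M (count_space UNIV)" for t
    by (rule meas) simp
  define D :: real where "D = Inf {}"
  have eq: "arrival \<nu> j \<omega> < x \<longleftrightarrow>
      (if \<exists>n::nat. j \<le> \<nu> (max 0 (real n)) \<omega> then \<exists>q\<in>{q\<in>\<rat>. 0 \<le> q \<and> q < x}. j \<le> \<nu> (max 0 q) \<omega> else D < x)"
    if \<omega>: "\<omega> \<in> space M" for \<omega>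
  proof -
    let ?A = "{t. 0 \<le> t \<and> j \<le> \<nu> t \<omega>}"
    have up: "t' \<in> ?A" if "t \<in> ?A" "t \<le> t'" for t t'
      using that mono_onD[OF mono[OF \<omega>], of t t'] by auto
    have ex: "?A \<noteq> {} \<longleftrightarrow> (\<exists>n::nat. j \<le> \<nu> (max 0 (real n)) \<omega>)"
    proof
      assume "?A \<noteq> {}"
      then obtain t where t: "t \<in> ?A" by auto
      obtain n :: nat where "t \<le> real n" using real_arch_simple by auto
      with up[OF t] show "\<exists>n::nat. j \<le> \<nu> (max 0 (real n)) \<omega>" by auto
    next
      assume "\<exists>n::nat. j \<le> \<nu> (max 0 (real n)) \<omega>"
      then obtain n :: nat where "real n \<in> ?A" by auto
      then show "?A \<noteq> {}" by blast
    qed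
    show ?thesis
    proof (cases "?A = {}")
      case True
      then show ?thesis using ex unfolding arrival_def D_def True by simp
    next
      case False
      have "bdd_below ?A" by (rule bdd_belowI[of _ 0]) auto
      then have "arrival \<nu> j \<omega> < x \<longleftrightarrow> (\<exists>t\<in>?A. t < x)"
        unfolding arrival_def by (intro cInf_less_iff False)
      also have "\<dots> \<longleftrightarrow> (\<exists>q\<in>{q\<in>\<rat>. 0 \<le> q \<and> q < x}. j \<le> \<nu> (max 0 q) \<omega>)"
      proof
        assume "\<exists>t\<in>?A. t < x"
        then obtain t where t: "t \<in> ?A" "t < x" by auto
        obtain q where q: "q \<in> \<rat>" "t < q" "q < x" using Rats_dense_in_real[OF t(2)] by auto
        then have "q \<in> ?A" using up[OF t(1), of q] by auto
        with q show "\<exists>q\<in>{q\<in>\<rat>. 0 \<le> q \<and> q < x}. j \<le> \<nu> (max 0 q) \<omega>" by auto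
      qed auto
      finally show ?thesis using False ex by simp
    qed
  qed
  have [simp]: "countable {q\<in>\<rat>. 0 \<le> q \<and> q < x}"
    using countable_rat by (rule countable_subset[rotated]) auto
  have "{\<omega> \<in> space M. arrival \<nu> j \<omega> < x} = {\<omega> \<in> space M. if \<exists>n::nat. j \<le> \<nu> (max 0 (real n)) \<omega>
      then \<exists>q\<in>{q\<in>\<rat>. 0 \<le> q \<and> q < x}. j \<le> \<nu> (max 0 q) \<omega> else D < x}"
    by (intro Collect_cong conj_cong refl eq)
  also have "\<dots> \<in> sets M" by measurable
  finally show "{\<omega> \<in> space M. arrival \<nu> j \<omega> < x} \<in> sets M" .
qed

lemma arrival_ge:
  assumes "\<And>t. 0 \<le> t \<Longrightarrow> 1 \<le> \<nu> t \<omega> \<Longrightarrow> a \<le> t" and "0 \<le> t" "1 \<le> j" "j \<le> \<nu> t \<omega>"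
  shows "a \<le> arrival \<nu> j \<omega>"
  unfolding arrival_def using assms by (intro cInf_greatest) (auto intro: order_trans)

text \<open>The event that all times \<open>1 / n\<close> come after a jump has probability at most
  \<open>1 - exp (- rate / n)\<close> for each \<open>n\<close>. Right-continuous paths starting at \<open>0\<close> never have a jump at
  time \<open>0\<close>, but left-continuous ones may, on a null set.\<close>

lemma (in prob_space) AE_poisson_process_no_early_jump:
  assumes \<nu>: "poisson_process rate \<nu>" and rate: "0 < rate"
  shows "AE \<omega> in M. \<exists>a>0. \<forall>t\<ge>0. 1 \<le> \<nu> t \<omega> \<longrightarrow> a \<le> t"
proof -
  have meas [measurable]: "\<nu> (1 / real (Suc n)) \<in> measurable M (count_space UNIV)" for n
    using \<nu> by (simp add: poisson_process_def)
  have mono: "\<nu> s \<omega> \<le> \<nu> t \<omega>" if "\<omega> \<in> space M" "0 \<le> s" "s \<le> t" for s t \<omega>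
    using \<nu> that by (auto simp: poisson_process_def intro: mono_onD)
  have prob0: "prob {\<omega> \<in> space M. \<nu> (1 / real (Suc n)) \<omega> = 0} = exp (- (rate / real (Suc n)))" for n
  proof -
    have 0: "\<nu> 0 \<omega> = 0" if "\<omega> \<in> space M" for \<omega>
      using \<nu> that by (simp add: poisson_process_def)
    have "distr M (count_space UNIV) (\<lambda>\<omega>. \<nu> (1 / real (Suc n)) \<omega> - \<nu> 0 \<omega>) = measure_pmf (poisson_pmf (rate * (1 / real (Suc n) - 0)))"
      using \<nu> by (auto simp: poisson_process_def)
    also have "distr M (count_space UNIV) (\<lambda>\<omega>. \<nu> (1 / real (Suc n)) \<omega> - \<nu> 0 \<omega>) = distr M (count_space UNIV) (\<nu> (1 / real (Suc n)))"
      using 0 by (intro distr_cong) auto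
    finally have "measure (distr M (count_space UNIV) (\<nu> (1 / real (Suc n)))) {0} = pmf (poisson_pmf (rate / real (Suc n))) 0"
      by (simp add: measure_pmf_single)
    also have "\<dots> = exp (- (rate / real (Suc n)))"
      using rate by (subst pmf_poisson) auto
    finally show ?thesis
      by (subst (asm) measure_distr[OF meas]) (auto simp: vimage_def Int_def conj_commute)
  qed
  let ?B = "{\<omega> \<in> space M. \<forall>n. \<nu> (1 / real (Suc n)) \<omega> \<noteq> 0}"
  have "prob ?B \<le> 1 - exp (- (rate / real (Suc n)))" for n
  proof -
    have "prob ?B \<le> prob {\<omega> \<in> space M. \<not> \<nu> (1 / real (Suc n)) \<omega> = 0}"
      by (intro finite_measure_mono) (auto simp del: of_nat_Suc)
    also have "\<dots> = 1 - exp (- (rate / real (Suc n)))"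
      using prob_neg[of "\<lambda>\<omega>. \<nu> (1 / real (Suc n)) \<omega> = 0"] prob0[of n]
      by (simp del: of_nat_Suc)
    finally show ?thesis .
  qed
  moreover have "(\<lambda>n. 1 - exp (- (rate / real (Suc n)))) \<longlonglongrightarrow> 1 - exp (- 0)"
    by (intro tendsto_intros LIMSEQ_Suc lim_const_over_n)
  ultimately have "prob ?B \<le> 0"
    by (intro LIMSEQ_le_const[where X = "\<lambda>n. 1 - exp (- (rate / real (Suc n)))"]) auto
  then have "AE \<omega> in M. \<not> (\<forall>n. \<nu> (1 / real (Suc n)) \<omega> \<noteq> 0)"
    by (subst AE_iff_measurable[OF _ refl]) (auto simp: emeasure_eq_measure measure_le_0_iff simp del: of_nat_Suc)
  then show ?thesis
  proof (rule AE_mp, intro AE_I2 impI)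
    fix \<omega> assume \<omega>: "\<omega> \<in> space M" and "\<not> (\<forall>n. \<nu> (1 / real (Suc n)) \<omega> \<noteq> 0)"
    then obtain n where n: "\<nu> (1 / real (Suc n)) \<omega> = 0" by auto
    have "1 / real (Suc n) \<le> t" if "t \<ge> 0" "1 \<le> \<nu> t \<omega>" for t
      using mono[OF \<omega>, of t "1 / real (Suc n)"] n that by (cases "1 / real (Suc n) \<le> t") auto
    then show "\<exists>a>0. \<forall>t\<ge>0. 1 \<le> \<nu> t \<omega> \<longrightarrow> a \<le> t"
      by (intro exI[of _ "1 / real (Suc n)"]) auto
  qed
qed

section \<open>Walks with positive drift\<close>

text \<open>The bound \<open>K\<close> depends on \<open>z\<close> and \<open>\<eta>\<close> only, so that it serves all drifts \<open>d\<close> above \<open>\<eta>\<close> at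
  once; this uniformity is what makes the final bound independent of \<open>c\<close>.\<close>

lemma eventually_positive_drifted_sum:
  fixes z :: "nat \<Rightarrow> real"
  assumes z: "(\<lambda>k. (\<Sum>j=1..k. z j) / k) \<longlonglongrightarrow> 0" and "\<eta> > 0"
  obtains K where "\<And>k d. k > K \<Longrightarrow> (\<And>j. 1 \<le> j \<Longrightarrow> j \<le> k \<Longrightarrow> \<eta> \<le> d j) \<Longrightarrow> 0 < (\<Sum>j=1..k. z j + d j)"
proof -
  have "\<forall>\<^sub>F k in sequentially. - \<eta> < (\<Sum>j=1..k. z j) / k"
    using z \<open>\<eta> > 0\<close> by (intro order_tendstoD) auto
  then obtain K where K: "\<And>k. k \<ge> K \<Longrightarrow> - \<eta> < (\<Sum>j=1..k. z j) / k"
    by (auto simp: eventually_sequentially)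
  show ?thesis
  proof (rule that)
    fix k d assume k: "k > K" and d: "\<And>j. 1 \<le> j \<Longrightarrow> j \<le> k \<Longrightarrow> \<eta> \<le> d j"
    have "0 < (\<Sum>j=1..k. z j) + k * \<eta>"
      using K[of k] k by (simp add: field_simps)
    also have "k * \<eta> \<le> (\<Sum>j=1..k. d j)"
      using d sum_bounded_below[of "{1..k}" \<eta> d] by simp
    finally show "0 < (\<Sum>j=1..k. z j + d j)"
      by (simp add: sum.distrib)
  qed
qed

text \<open>One half of the walk behind \<open>\<Lambda>\<^sub>c\<close>: \<open>z\<close> stands for the errors, \<open>s j\<close> for the arrival times and \<open>P\<close> for the
  levels that the path visits, as only at those does the arrival time carry the lower bound \<open>a\<close>.
  By monotonicity all drifts \<open>g (c * s j)\<close> exceed \<open>\<delta> / 2\<close> as soon as \<open>g (c * a)\<close> does.\<close>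

lemma
  fixes z s :: "nat \<Rightarrow> real" and P :: "nat set"
  assumes z: "(\<lambda>k. (\<Sum>j=1..k. z j) / k) \<longlonglongrightarrow> 0"
    and g: "mono g" "(g \<longlongrightarrow> \<delta>) at_top" "\<delta> > 0"
    and s: "a > 0" "\<forall>k\<in>P. \<forall>j\<in>{1..k}. a \<le> s j"
  shows one_sided_walk_positive: "\<exists>K. (\<forall>\<^sub>F c in at_top. \<forall>k\<in>P. K < k \<longrightarrow> 0 < (\<Sum>j=1..k. z j + g (c * s j))) \<and>
            (\<forall>k>K. 0 < (\<Sum>j=1..k. z j + \<delta>))"
    and one_sided_walk_tendsto: "k \<in> P \<Longrightarrow> ((\<lambda>c. \<Sum>j=1..k. z j + g (c * s j)) \<longlongrightarrow> (\<Sum>j=1..k. z j + \<delta>)) at_top"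
proof -
  obtain K where K: "\<And>k d. k > K \<Longrightarrow> (\<And>j. 1 \<le> j \<Longrightarrow> j \<le> k \<Longrightarrow> \<delta> / 2 \<le> d j) \<Longrightarrow> 0 < (\<Sum>j=1..k. z j + d j)"
    using eventually_positive_drifted_sum[OF z, of "\<delta> / 2"] g(3) by auto
  have scaled: "filterlim (\<lambda>c. c * b) at_top at_top" if "b > 0" for b :: real
    using that by (intro filterlim_at_top_mult_tendsto_pos[OF tendsto_const]) (auto intro: filterlim_ident)
  have "\<forall>\<^sub>F c in at_top. \<delta> / 2 < g (c * a)"
    using filterlim_compose[OF g(2) scaled[OF s(1)]] g(3) by (intro order_tendstoD) auto
  then have "\<forall>\<^sub>F c in at_top. \<forall>k\<in>P. K < k \<longrightarrow> 0 < (\<Sum>j=1..k. z j + g (c * s j))"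
    using eventually_ge_at_top[of 0]
  proof eventually_elim
    case (elim c)
    show ?case
    proof (intro ballI impI K)
      fix k j assume "k \<in> P" "K < k" "1 \<le> j" "j \<le> k"
      then have "c * a \<le> c * s j" using s(2) elim(2) by (intro mult_left_mono) auto
      from monoD[OF g(1) this] elim(1) show "\<delta> / 2 \<le> g (c * s j)" by simp
    qed
  qed
  moreover have "\<forall>k>K. 0 < (\<Sum>j=1..k. z j + \<delta>)"
    using K[of _ "\<lambda>_. \<delta>"] g(3) by auto
  ultimately show "\<exists>K. (\<forall>\<^sub>F c in at_top. \<forall>k\<in>P. K < k \<longrightarrow> 0 < (\<Sum>j=1..k. z j + g (c * s j))) \<and>
            (\<forall>k>K. 0 < (\<Sum>j=1..k. z j + \<delta>))"
    by blast
  show "((\<lambda>c. \<Sum>j=1..k. z j + g (c * s j)) \<longlongrightarrow> (\<Sum>j=1..k. z j + \<delta>)) at_top" if "k \<in> P"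
  proof (intro tendsto_intros filterlim_compose[OF g(2)] scaled)
    fix j assume "j \<in> {1..k}"
    then show "0 < s j" using s that by force
  qed
qed

text \<open>Two values on the same side differ by a sum of independent errors plus a constant. A value on the
  right and one on the left differ by the sum of errors of both kinds plus a constant. Neither sum has
  atoms, and there are only countably many pairs of levels.\<close>

lemma (in prob_space) AE_walk_inj:
  assumes Z: "indep_vars (\<lambda>_. borel) Z {1..}" "\<And>j c. j \<ge> 1 \<Longrightarrow> AE \<omega> in M. Z j \<omega> \<noteq> c"
    and Z': "indep_vars (\<lambda>_. borel) Z' {1..}" "\<And>j c. j \<ge> 1 \<Longrightarrow> AE \<omega> in M. Z' j \<omega> \<noteq> c"
    and ind: "indep_set (generated_events M borel {1..} Z) (generated_events M borel {1..} Z')"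
  shows "AE \<omega> in M. inj (walk (\<lambda>j. Z j \<omega> + \<delta>) (\<lambda>j. - Z' j \<omega> + \<delta>'))"
proof -
  let ?w = "\<lambda>\<omega>. walk (\<lambda>j. Z j \<omega> + \<delta>) (\<lambda>j. - Z' j \<omega> + \<delta>')"
  have split: "(\<Sum>j=1..n. d j) = (\<Sum>j=1..m. d j) + (\<Sum>j\<in>{m<..n}. d j)" if "m \<le> n" for m n and d :: "nat \<Rightarrow> real"
  proof -
    have "{1..n} = {1..m} \<union> {m<..n}" using that by auto
    then show ?thesis by (simp only:) (subst sum.union_disjoint, auto)
  qed
  have same: "AE \<omega> in M. (\<Sum>j=1..m. Z j \<omega> + d) \<noteq> (\<Sum>j=1..n. Z j \<omega> + d)"
    if "m < n" and Z: "indep_vars (\<lambda>_. borel) Z {1..}" "\<And>j c. j \<ge> 1 \<Longrightarrow> AE \<omega> in M. Z j \<omega> \<noteq> c"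
    for m n d and Z :: "nat \<Rightarrow> 'a \<Rightarrow> real"
  proof -
    have "AE \<omega> in M. (\<Sum>j\<in>{m<..n}. Z j \<omega>) \<noteq> - (real (n - m) * d)"
      using that by (intro AE_indep_sum_neq[OF Z(1)] Z(2)) auto
    then show ?thesis
    proof eventually_elim
      case (elim \<omega>)
      then show ?case
        using split[of m n "\<lambda>j. Z j \<omega> + d"] that(1) by (auto simp: sum.distrib)
    qed
  qed
  have cross: "AE \<omega> in M. (\<Sum>j=1..n. - Z' j \<omega> + \<delta>') \<noteq> (\<Sum>j=1..m. Z j \<omega> + \<delta>)" if "m \<ge> 1" for m n
  proof -
    have "indep_var borel (\<lambda>\<omega>. \<Sum>j\<in>{1..m}. Z j \<omega>) borel (\<lambda>\<omega>. \<Sum>j\<in>{1..n}. Z' j \<omega>)"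
      using Z(1) Z'(1) by (intro indep_var_sums_if_indep_generated_events[OF ind]) (auto simp: indep_vars_def)
    moreover have "AE \<omega> in M. (\<Sum>j\<in>{1..m}. Z j \<omega>) \<noteq> c" for c
      using that by (intro AE_indep_sum_neq[OF Z(1)] Z(2)) auto
    ultimately have "AE \<omega> in M. (\<Sum>j\<in>{1..m}. Z j \<omega>) + (\<Sum>j\<in>{1..n}. Z' j \<omega>) \<noteq> n * \<delta>' - m * \<delta>"
      by (rule AE_indep_add_neq)
    then show ?thesis
      by eventually_elim (auto simp: sum.distrib sum_negf sum_subtractf)
  qed
  have less: "AE \<omega> in M. ?w \<omega> k \<noteq> ?w \<omega> l" if "k < l" for k l
  proof -
    consider "0 \<le> k" | "k < 0" "0 < l" | "l \<le> 0" using that by linarith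
    then show ?thesis
    proof cases
      case 1
      then show ?thesis
        using same[OF _ Z, of "nat k" "nat l" \<delta>] that by (auto simp: walk_def)
    next
      case 2
      then show ?thesis
        using cross[of "nat l" "nat (- k)"] by (auto simp: walk_def)
    next
      case 3
      have nonpos: "?w \<omega> i = - (\<Sum>j=1..nat (- i). Z' j \<omega> + - \<delta>')" if "i \<le> 0" for i \<omega>
        using that by (cases "i = 0") (auto simp: walk_def simp flip: sum_negf)
      have "AE \<omega> in M. (\<Sum>j=1..nat (- l). Z' j \<omega> + - \<delta>') \<noteq> (\<Sum>j=1..nat (- k). Z' j \<omega> + - \<delta>')"
        using that 3 by (intro same Z') auto
      then show ?thesis
        unfolding nonpos[OF 3] nonpos[OF order_trans[OF less_imp_le[OF \<open>k < l\<close>] 3]]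
        unfolding neg_equal_iff_equal by eventually_elim (rule not_sym)
    qed
  qed
  have "AE \<omega> in M. \<forall>k l. k < l \<longrightarrow> ?w \<omega> k \<noteq> ?w \<omega> l"
    unfolding AE_all_countable by (intro allI AE_impI less)
  then show ?thesis
    by eventually_elim (rule linorder_injI, blast)
qed

section \<open>Convergence of the smallest minimizers\<close>

text \<open>A positive derivative makes \<open>f\<close> take values strictly above and strictly below \<open>f x\<close>, and the limits
  of a monotone function bound all its values.\<close>

lemma limits_strict_if_deriv_pos:
  fixes f :: "real \<Rightarrow> real"
  assumes "mono f" "(f \<longlongrightarrow> l) at_bot" "(f \<longlongrightarrow> u) at_top" "f differentiable (at x)" "deriv f x > 0"
  shows "l < f x" "f x < u"
proof -
  have der: "DERIV f x :> deriv f x"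
    using assms(4) by (simp add: DERIV_deriv_iff_real_differentiable)
  obtain d where d: "d > 0" "\<And>h. h > 0 \<Longrightarrow> h < d \<Longrightarrow> f x < f (x + h)"
    using DERIV_pos_inc_right[OF der assms(5)] by auto
  have "f (x + d / 2) \<le> u"
    using assms(1) by (intro tendsto_lowerbound[OF assms(3)] eventually_at_top_linorderI[of "x + d / 2"]) (auto simp: mono_def)
  with d(2)[of "d / 2"] d(1) show "f x < u" by simp
  obtain d where d: "d > 0" "\<And>h. h > 0 \<Longrightarrow> h < d \<Longrightarrow> f (x - h) < f x"
    using DERIV_pos_inc_left[OF der assms(5)] by auto
  have "l \<le> f (x - d / 2)"
    using assms(1) by (intro tendsto_upperbound[OF assms(2)] eventually_at_bot_linorderI[of "x - d / 2"]) (auto simp: mono_def)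
  with d(2)[of "d / 2"] d(1) show "l < f x" by simp
qed

text \<open>The pathwise core: all assumptions on \<open>\<omega>\<close> hold almost surely. The competing levels
  are those in \<open>L\<close>, the visited levels between the bounds \<open>- K'\<close> and \<open>K\<close> beyond which the walks stay
  positive; all others lose against level \<open>0\<close>, which is visited at \<open>h = 0\<close>.\<close>

lemma eventually_smallest_argmin_Lambda_eq:
  fixes f :: "real \<Rightarrow> real"
  assumes f: "mono f" "(f \<longlongrightarrow> \<beta>l) at_bot" "(f \<longlongrightarrow> \<beta>u) at_top" "\<beta>l < f \<xi>0" "f \<xi>0 < \<beta>u"
    and avg: "(\<lambda>k. (\<Sum>j=1..k. e j \<omega>) / k) \<longlonglongrightarrow> 0" "(\<lambda>k. (\<Sum>j=1..k. e' j \<omega>) / k) \<longlonglongrightarrow> 0"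
    and inj: "inj (walk (\<lambda>j. e j \<omega> + (\<beta>u - f \<xi>0)) (\<lambda>j. - e' j \<omega> + (f \<xi>0 - \<beta>l)))"
    and start: "\<nu> 0 \<omega> = 0"
    and gap: "a > 0" "\<And>t. t \<ge> 0 \<Longrightarrow> 1 \<le> \<nu> t \<omega> \<Longrightarrow> a \<le> t"
    and gap': "a' > 0" "\<And>t. t \<ge> 0 \<Longrightarrow> 1 \<le> \<nu>' t \<omega> \<Longrightarrow> a' \<le> t"
  shows "\<forall>\<^sub>F c in at_top. smallest_argmin (Lambda f \<xi>0 \<nu> \<nu>' e e' c \<omega>)
           = smallest_argmin (Lambda_tilde f \<xi>0 \<beta>l \<beta>u \<nu> \<nu>' e e' \<omega>)"
proof -
  define w where "w c = walk (\<lambda>j. e j \<omega> + (f (\<xi>0 + c * arrival \<nu> j \<omega>) - f \<xi>0))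
       (\<lambda>j. - e' j \<omega> + (f \<xi>0 - f (\<xi>0 - c * arrival \<nu>' j \<omega>)))" for c
  define w0 where "w0 = walk (\<lambda>j. e j \<omega> + (\<beta>u - f \<xi>0)) (\<lambda>j. - e' j \<omega> + (f \<xi>0 - \<beta>l))"
  define lev where "lev = level \<nu> \<nu>' \<omega>"
  define P where "P = {\<nu> t \<omega> |t. t \<ge> 0}"
  define P' where "P' = {\<nu>' t \<omega> |t. t \<ge> 0}"
  have P: "nat l \<in> P" if "l \<in> range lev" "l \<ge> 0" for l
    using that start by (force simp: lev_def level_def P_def split: if_splits)
  have P': "nat (- l) \<in> P'" if "l \<in> range lev" "l < 0" for l
    using that by (force simp: lev_def level_def P'_def split: if_splits)
  have s: "\<forall>k\<in>P. \<forall>j\<in>{1..k}. a \<le> arrival \<nu> j \<omega>"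
    using gap(2) by (auto simp: P_def intro!: arrival_ge)
  have s': "\<forall>k\<in>P'. \<forall>j\<in>{1..k}. a' \<le> arrival \<nu>' j \<omega>"
    using gap'(2) by (auto simp: P'_def intro!: arrival_ge)
  have avg': "(\<lambda>k. (\<Sum>j=1..k. - e' j \<omega>) / k) \<longlonglongrightarrow> 0"
    using tendsto_minus[OF avg(2)] by (simp add: sum_negf)
  have g: "mono (\<lambda>x. f (\<xi>0 + x) - f \<xi>0)" "((\<lambda>x. f (\<xi>0 + x) - f \<xi>0) \<longlongrightarrow> \<beta>u - f \<xi>0) at_top"
    using f(1) by (auto simp: mono_def intro!: tendsto_intros filterlim_compose[OF f(3)] filterlim_tendsto_add_at_top filterlim_ident)
  have "filterlim (\<lambda>x. \<xi>0 - x) at_bot at_top"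
    unfolding filterlim_at_bot
  proof
    fix Z show "\<forall>\<^sub>F x in at_top. \<xi>0 - x \<le> Z"
      using eventually_ge_at_top[of "\<xi>0 - Z"] by eventually_elim simp
  qed
  then have g': "mono (\<lambda>x. f \<xi>0 - f (\<xi>0 - x))" "((\<lambda>x. f \<xi>0 - f (\<xi>0 - x)) \<longlongrightarrow> f \<xi>0 - \<beta>l) at_top"
    using f(1) by (auto simp: mono_def intro!: tendsto_intros filterlim_compose[OF f(2)])
  note right = one_sided_walk_positive[OF avg(1) g _ gap(1) s] one_sided_walk_tendsto[OF avg(1) g _ gap(1) s]
  note left = one_sided_walk_positive[OF avg' g' _ gap'(1) s'] one_sided_walk_tendsto[OF avg' g' _ gap'(1) s']
  obtain K where K: "\<forall>\<^sub>F c in at_top. \<forall>k\<in>P. K < k \<longrightarrow> 0 < (\<Sum>j=1..k. e j \<omega> + (f (\<xi>0 + c * arrival \<nu> j \<omega>) - f \<xi>0))"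
      "\<forall>k>K. 0 < (\<Sum>j=1..k. e j \<omega> + (\<beta>u - f \<xi>0))"
    using right(1) f(5) by auto
  obtain K' where K': "\<forall>\<^sub>F c in at_top. \<forall>k\<in>P'. K' < k \<longrightarrow> 0 < (\<Sum>j=1..k. - e' j \<omega> + (f \<xi>0 - f (\<xi>0 - c * arrival \<nu>' j \<omega>)))"
      "\<forall>k>K'. 0 < (\<Sum>j=1..k. - e' j \<omega> + (f \<xi>0 - \<beta>l))"
    using left(1) f(4) by auto
  define L where "L = {l \<in> range lev. - int K' \<le> l \<and> l \<le> int K}"
  have "finite L" unfolding L_def by (rule finite_subset[of _ "{- int K'..int K}"]) auto
  moreover have "L \<subseteq> range lev" by (auto simp: L_def)
  moreover have "0 \<in> L"
    using start by (auto simp: L_def lev_def level_def intro!: image_eqI[where x = 0])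
  moreover have "\<forall>\<^sub>F c in at_top. \<forall>l\<in>range lev - L. w c 0 < w c l"
    using K(1) K'(1)
  proof eventually_elim
    case (elim c)
    show ?case
    proof
      fix l assume l: "l \<in> range lev - L"
      show "w c 0 < w c l"
      proof (cases "l \<ge> 0")
        case True
        then have "K < nat l" "nat l \<in> P" using l P by (auto simp: L_def)
        with elim(1) True show ?thesis by (simp add: w_def walk_def)
      next
        case False
        then have "K' < nat (- l)" "nat (- l) \<in> P'" using l P' by (auto simp: L_def)
        with elim(2) False show ?thesis by (simp add: w_def walk_def)
      qed
    qed
  qed
  moreover have "\<forall>l\<in>range lev - L. w0 0 < w0 l"
  proof
    fix l assume l: "l \<in> range lev - L"
    show "w0 0 < w0 l"
    proof (cases "l \<ge> 0")
      case True
      then have "K < nat l" using l by (auto simp: L_def)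
      with K(2) True show ?thesis by (simp add: w0_def walk_def)
    next
      case False
      then have "K' < nat (- l)" using l by (auto simp: L_def)
      with K'(2) False show ?thesis by (simp add: w0_def walk_def)
    qed
  qed
  moreover have "((\<lambda>c. w c l) \<longlongrightarrow> w0 l) at_top" if "l \<in> L" for l
    using that P[of l] P'[of l] right(2)[of "nat l"] left(2)[of "nat (- l)"] f(4,5)
    by (cases "l \<ge> 0") (auto simp: L_def w_def w0_def walk_def)
  moreover have "inj_on w0 L"
    using inj by (auto simp: w0_def intro: inj_on_subset)
  ultimately have "\<forall>\<^sub>F c in at_top. smallest_argmin (\<lambda>h. w c (lev h)) = smallest_argmin (\<lambda>h. w0 (lev h))"
    by (rule eventually_smallest_argmin_eq)
  moreover have "Lambda f \<xi>0 \<nu> \<nu>' e e' c \<omega> = (\<lambda>h. w c (lev h))" for c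
    by (rule ext) (simp add: Lambda_eq_walk w_def lev_def)
  moreover have "Lambda_tilde f \<xi>0 \<beta>l \<beta>u \<nu> \<nu>' e e' \<omega> = (\<lambda>h. w0 (lev h))"
    by (rule ext) (simp add: Lambda_tilde_eq_walk w0_def lev_def)
  ultimately show ?thesis by simp
qed

theorem theorem4p3:
  fixes f pX :: "real \<Rightarrow> real" and \<theta>0 \<beta>l0 \<beta>u0 \<xi>0 \<sigma> :: real
    and \<alpha> \<theta> \<beta>l \<beta>u \<xi> :: "nat \<Rightarrow> real"
    and N :: "'b measure" and X eps :: "'b \<Rightarrow> real"
    and M :: "'a measure" and \<nu>p \<nu>m :: "real \<Rightarrow> 'a \<Rightarrow> nat" and e e' :: "nat \<Rightarrow> 'a \<Rightarrow> real"
  assumes theta0: "0 < \<theta>0" "\<theta>0 < 1"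
    and f: "smooth_real f" "bounded (range f)" "mono f"
    and beta0: "(f \<longlongrightarrow> \<beta>l0) at_bot" "(f \<longlongrightarrow> \<beta>u0) at_top"
    and alpha: "\<And>n. \<alpha> n > 0" "filterlim \<alpha> at_top sequentially"
    \<comment> \<open>the regression model\<close>
    and N: "prob_space N"
    and X: "\<And>\<omega>. \<omega> \<in> space N \<Longrightarrow> X \<omega> \<in> {0..1}"
    and pX: "\<And>x. 0 \<le> pX x" "distributed N lborel X (\<lambda>x. ennreal (pX x))"
    and eps_rv: "eps \<in> borel_measurable N"
    and eps_cont: "\<And>x. isCont (cdf (distr N borel eps)) x"
    and X_eps_indep: "prob_space.indep_var N borel X borel eps"
    and eps_mean: "integrable N eps" "prob_space.expectation N eps = 0"
    and eps_var: "integrable N (\<lambda>\<omega>. (eps \<omega>)\<^sup>2)" "prob_space.variance N eps = \<sigma>\<^sup>2"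
    and minimizer: "\<And>n p. is_arg_min (stump_risk N X eps (\<lambda>x. f (\<alpha> n * (x - \<theta>0)))) (\<lambda>_. True) p
        \<longleftrightarrow> p = (\<theta> n, \<beta>l n, \<beta>u n)"
    and beta_neq: "\<And>n. \<beta>l n \<noteq> \<beta>u n"
    and xi: "\<And>n. \<xi> n = \<alpha> n * (\<theta> n - \<theta>0)"
    and xi0: "\<xi>0 = inv f ((\<beta>l0 + \<beta>u0) / 2)"
    \<comment> \<open>Assumptions A, B, C1, C2, C3\<close>
    and A: "continuously_differentiable_near f \<xi>0" "deriv f \<xi>0 > 0"
    and B: "\<forall>\<^sub>F x in nhds \<theta>0. pX x \<noteq> 0" "continuously_differentiable_near pX \<theta>0"
    and C1: "(INF n. Liminf at_infinity (\<lambda>h :: real.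
        ereal (1 / \<bar>h\<bar> * (LBINT t=ereal 0..ereal h. f (t + \<xi> n) - f (\<xi> n))))) > 0"
    and C2: "\<And>K :: real. K > 0 \<Longrightarrow>
        (INF n. INF u \<in> {- K + \<xi> n .. K + \<xi> n}. ereal (deriv f u)) > 0"
    and C3: "set_integrable lborel {..\<xi>0} (\<lambda>t. f t - \<beta>l0)"
        "set_integrable lborel {\<xi>0..} (\<lambda>t. f t - \<beta>u0)"
    \<comment> \<open>the limiting processes\<close>
    and M: "prob_space M"
    and nu_plus: "prob_space.poisson_process M (pX \<theta>0) \<nu>p"
        "\<And>\<omega>. \<omega> \<in> space M \<Longrightarrow> rcll_path (\<lambda>t. \<nu>p t \<omega>)"
    and nu_minus: "prob_space.poisson_process M (pX \<theta>0) \<nu>m"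
        "\<And>\<omega>. \<omega> \<in> space M \<Longrightarrow> lcrl_path (\<lambda>t. \<nu>m t \<omega>)"
    and errors: "prob_space.iid_sequence M (distr N borel eps) e"
        "prob_space.iid_sequence M (distr N borel eps) e'"
    and indep: "prob_space.indep_sets M
        ((!) [generated_events M (count_space UNIV) {0..} \<nu>p,
              generated_events M (count_space UNIV) {0..} \<nu>m,
              generated_events M borel {1..} e,
              generated_events M borel {1..} e']) {..<4}"
  shows "weak_conv_m_along
           (\<lambda>c. distr M borel (\<lambda>\<omega>. smallest_argmin (Lambda f \<xi>0 \<nu>p \<nu>m e e' c \<omega>)))
           (distr M borel (\<lambda>\<omega>. smallest_argmin (Lambda_tilde f \<xi>0 \<beta>l0 \<beta>u0 \<nu>p \<nu>m e e' \<omega>)))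
           at_top"
proof -
  interpret M: prob_space M by (rule M)
  let ?D = "distr N borel eps"
  have D: "integrable ?D (\<lambda>x. x)" "(\<integral>x. x \<partial>?D) = 0" "integrable ?D (\<lambda>x. x\<^sup>2)"
    using eps_rv eps_mean eps_var(1) by (auto simp: integrable_distr_eq integral_distr)
  note e_facts = M.iid_sequence_measurable[OF errors(1) D] M.iid_sequence_atomless[OF errors(1) D]
    M.iid_sequence_average_tendsto_0[OF errors(1) D]
  note e'_facts = M.iid_sequence_measurable[OF errors(2) D] M.iid_sequence_atomless[OF errors(2) D]
    M.iid_sequence_average_tendsto_0[OF errors(2) D]
  have f_diff: "f differentiable (at \<xi>0)"
    using f(1) unfolding smooth_real_def by (auto dest: spec[of _ 0])
  note strict = limits_strict_if_deriv_pos[OF f(3) beta0 f_diff A(2)]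
  have rate: "0 < pX \<theta>0"
    using pX(1)[of \<theta>0] eventually_nhds_x_imp_x[OF B(1)] by simp
  have \<nu>_meas: "\<nu>p t \<in> measurable M (count_space UNIV)" "\<nu>m t \<in> measurable M (count_space UNIV)" if "t \<ge> 0" for t
    using nu_plus(1) nu_minus(1) that by (auto simp: M.poisson_process_def)
  have \<nu>_mono: "mono_on {0..} (\<lambda>t. \<nu>p t \<omega>)" "mono_on {0..} (\<lambda>t. \<nu>m t \<omega>)" and \<nu>_0: "\<nu>p 0 \<omega> = 0"
    if "\<omega> \<in> space M" for \<omega>
    using nu_plus(1) nu_minus(1) that by (auto simp: M.poisson_process_def)
  have [measurable]: "arrival \<nu>p j \<in> borel_measurable M" "arrival \<nu>m j \<in> borel_measurable M" for j
    by (rule arrival_measurable[OF \<nu>_meas(1) \<nu>_mono(1)] arrival_measurable[OF \<nu>_meas(2) \<nu>_mono(2)]; assumption)+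
  have [measurable]: "f \<in> borel_measurable borel"
    by (rule borel_measurable_mono[OF f(3)])
  have step: "\<forall>\<^sub>F h' in at_right h. level \<nu>p \<nu>m \<omega> h' = level \<nu>p \<nu>m \<omega> h" if "\<omega> \<in> space M" for \<omega> h
    using nu_plus(2)[OF that] nu_minus(2)[OF that] by (rule eventually_level_at_right)
  have meas: "(\<lambda>\<omega>. smallest_argmin (Lambda f \<xi>0 \<nu>p \<nu>m e e' c \<omega>)) \<in> borel_measurable M" for c
  proof (rule smallest_argmin_measurable)
    show "(\<lambda>\<omega>. Lambda f \<xi>0 \<nu>p \<nu>m e e' c \<omega> h) \<in> borel_measurable M" for h
      unfolding Lambda_eq_walk
    proof (rule walk_level_measurable[OF \<nu>_meas])
      fix j :: nat assume "j \<ge> 1"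
      note [measurable] = e_facts(1)[OF this] e'_facts(1)[OF this]
      show "(\<lambda>\<omega>. e j \<omega> + (f (\<xi>0 + c * arrival \<nu>p j \<omega>) - f \<xi>0)) \<in> borel_measurable M"
        "(\<lambda>\<omega>. - e' j \<omega> + (f \<xi>0 - f (\<xi>0 - c * arrival \<nu>m j \<omega>))) \<in> borel_measurable M"
        by measurable
    qed
    show "\<forall>\<^sub>F h' in at_right h. Lambda f \<xi>0 \<nu>p \<nu>m e e' c \<omega> h' = Lambda f \<xi>0 \<nu>p \<nu>m e e' c \<omega> h"
      if "\<omega> \<in> space M" for \<omega> h
      using step[OF that] unfolding Lambda_eq_walk by eventually_elim simp
  qed
  have meas_tilde: "(\<lambda>\<omega>. smallest_argmin (Lambda_tilde f \<xi>0 \<beta>l0 \<beta>u0 \<nu>p \<nu>m e e' \<omega>)) \<in> borel_measurable M"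
  proof (rule smallest_argmin_measurable)
    show "(\<lambda>\<omega>. Lambda_tilde f \<xi>0 \<beta>l0 \<beta>u0 \<nu>p \<nu>m e e' \<omega> h) \<in> borel_measurable M" for h
      unfolding Lambda_tilde_eq_walk
    proof (rule walk_level_measurable[OF \<nu>_meas])
      fix j :: nat assume "j \<ge> 1"
      note [measurable] = e_facts(1)[OF this] e'_facts(1)[OF this]
      show "(\<lambda>\<omega>. e j \<omega> + (\<beta>u0 - f \<xi>0)) \<in> borel_measurable M"
        "(\<lambda>\<omega>. - e' j \<omega> + (f \<xi>0 - \<beta>l0)) \<in> borel_measurable M"
        by measurable
    qed
    show "\<forall>\<^sub>F h' in at_right h. Lambda_tilde f \<xi>0 \<beta>l0 \<beta>u0 \<nu>p \<nu>m e e' \<omega> h'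
        = Lambda_tilde f \<xi>0 \<beta>l0 \<beta>u0 \<nu>p \<nu>m e e' \<omega> h" if "\<omega> \<in> space M" for \<omega> h
      using step[OF that] unfolding Lambda_tilde_eq_walk by eventually_elim simp
  qed
  \<comment> \<open>The errors are the entries 2 and 3 of the list, counted from 0.\<close>
  have ind_ee': "M.indep_set (generated_events M borel {1..} e) (generated_events M borel {1..} e')"
    using M.indep_set_if_indep_sets[OF indep, of 2 3] by (simp add: numeral_2_eq_2 numeral_3_eq_3)
  have inj: "AE \<omega> in M. inj (walk (\<lambda>j. e j \<omega> + (\<beta>u0 - f \<xi>0)) (\<lambda>j. - e' j \<omega> + (f \<xi>0 - \<beta>l0)))"
    using errors e_facts(2)[OF eps_cont] e'_facts(2)[OF eps_cont]
    by (intro M.AE_walk_inj ind_ee') (auto simp: M.iid_sequence_def)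
  have "AE \<omega> in M. \<forall>\<^sub>F c in at_top. smallest_argmin (Lambda f \<xi>0 \<nu>p \<nu>m e e' c \<omega>)
      = smallest_argmin (Lambda_tilde f \<xi>0 \<beta>l0 \<beta>u0 \<nu>p \<nu>m e e' \<omega>)"
    using e_facts(3) e'_facts(3) inj M.AE_poisson_process_no_early_jump[OF nu_plus(1) rate]
      M.AE_poisson_process_no_early_jump[OF nu_minus(1) rate] AE_space
  proof eventually_elim
    case (elim \<omega>)
    then obtain a a' where "a > 0" "\<And>t. t \<ge> 0 \<Longrightarrow> 1 \<le> \<nu>p t \<omega> \<Longrightarrow> a \<le> t"
      "a' > 0" "\<And>t. t \<ge> 0 \<Longrightarrow> 1 \<le> \<nu>m t \<omega> \<Longrightarrow> a' \<le> t"
      by blast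
    with elim show ?case
      by (intro eventually_smallest_argmin_Lambda_eq[OF f(3) beta0 strict, where a = a and a' = a'] \<nu>_0) auto
  qed
  then show ?thesis
    by (rule weak_conv_m_along_if_AE_eventually_eq[OF M meas meas_tilde])
qed

end
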